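(* Let $f:\mathbb{R}^n\to[0,\infty)$ be an integrable quasi-concave function. Let $\mu$ be a measure on $\mathbb{R}^n$ given by $d\mu(x)=\phi(x)\,dx$, where $\phi:\mathbb{R}^n\to[0,\infty)$ is radially decreasing. Then $$\int_0^1\int_{\mathbb{R}^n}\Delta_{-\infty,\theta}f(x)\,d\mu(x)\,d\theta\le\frac{2^n}{n+1}\int_0^\infty\ \sup_{y\in S_{\ge t}(f),\ \theta\in(0,1]}\frac{\mu\bigl((1-\theta)y-\theta S_{\ge t}(f)\bigr)}{\theta^n}\,dt$$ and $$\int_{\mathbb{R}^n}\widetilde{\Delta}_{-\infty}f(x)\,d\mu(x)\le2^n\int_0^\infty\ \sup_{y\in S_{\ge t}(f),\ \theta\in(0,1]}\frac{\mu\bigl((1-\theta)y-\theta S_{\ge t}(f)\bigr)}{\theta^n}\,dt.$$ In particular, by choosing $d\mu(x)=dx$, the Lebesgue measure, we get $$\int_0^1\int_{\mathbb{R}^n}\Delta_{-\infty,\theta}f(x)\,dx\,d\theta\le\frac{2^n}{n+1}\int_{\mathbb{R}^n}f(x)\,dx$$ and $$\int_{\mathbb{R}^n}\widetilde{\Delta}_{-\infty}f(x)\,dx\le2^n\int_{\mathbb{R}^n}f(x)\,dx.$$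
   Context: $f$ is quasi-concave if $f((1-\lambda)x+\lambda y)\ge\min\{f(x),f(y)\}$ for all $x,y\in\mathbb{R}^n$, $\lambda\in(0,1)$. $\phi$ is radially decreasing if $\phi(tx)\ge\phi(x)$ for all $t\in[0,1]$, $x\in\mathbb{R}^n$. For $\theta\in[0,1]$, $$\Delta_{-\infty,\theta}f(z)=\sup_{z=(1-\theta)x-\theta y}\min\{f(x),f(y)\},\qquad\widetilde{\Delta}_{-\infty}f(z)=\sup_{z=(1-\theta)x-\theta y,\ \theta\in[0,1]}\min\{f(x),f(y)\},$$ the suprema running over $x,y\in\mathbb{R}^n$ (and also over $\theta\in[0,1]$ in the second). $S_{\ge t}(f)=\{x\in\mathbb{R}^n:f(x)\ge t\}$. Sums and differences of sets are in the Minkowski sense.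
   Formalization: The two bounds for Δ̃ are stated under the added assumption that f attains its maximum at the origin; without it they fail (n=1, f=1 on [1,2] and 0 elsewhere, φ=1: left side 4, right side 2). φ is assumed Lebesgue measurable. *)

theory Defs
  imports "HOL-Analysis.Analysis"
begin

definition quasi_concave :: "(real ^ 'n \<Rightarrow> real) \<Rightarrow> bool" where
  "quasi_concave f \<longleftrightarrow>
     (\<forall>x y. \<forall>l\<in>{0<..<1}. min (f x) (f y) \<le> f ((1 - l) *\<^sub>R x + l *\<^sub>R y))"

definition radially_decreasing :: "(real ^ 'n \<Rightarrow> real) \<Rightarrow> bool" where
  "radially_decreasing \<phi> \<longleftrightarrow> (\<forall>x. \<forall>t\<in>{0..1}. \<phi> x \<le> \<phi> (t *\<^sub>R x))"

text \<open>The suprema below are taken in the extended nonnegative reals: an integrable quasi-concave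
  function need not be bounded, so they can be infinite.\<close>

definition Delta :: "real \<Rightarrow> (real ^ 'n \<Rightarrow> real) \<Rightarrow> real ^ 'n \<Rightarrow> ennreal" where
  "Delta \<theta> f z =
     (SUP (x, y) \<in> {(x, y). z = (1 - \<theta>) *\<^sub>R x - \<theta> *\<^sub>R y}. ennreal (min (f x) (f y)))"

definition Delta_tilde :: "(real ^ 'n \<Rightarrow> real) \<Rightarrow> real ^ 'n \<Rightarrow> ennreal" where
  "Delta_tilde f z =
     (SUP (\<theta>, x, y) \<in> {(\<theta>, x, y). \<theta> \<in> {0..1} \<and> z = (1 - \<theta>) *\<^sub>R x - \<theta> *\<^sub>R y}.
        ennreal (min (f x) (f y)))"

text \<open>Superlevel sets of Delta_tilde f are essentially convex hulls of K and -K, with K a superlevel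
  set of f. The Rogers-Shephard volume bound with constant 2 ^ n for these hulls requires the origin
  to lie in K, and fails for K = [1, 2] in dimension one. The bounds for Delta_tilde are therefore
  stated for functions attaining their maximum at the origin.\<close>

definition superlevel :: "real \<Rightarrow> (real ^ 'n \<Rightarrow> real) \<Rightarrow> (real ^ 'n) set" where
  "superlevel t f = {x. t \<le> f x}"

text \<open>Lebesgue measure is the completed one throughout: superlevel sets of quasi-concave functions
  are convex, hence Lebesgue measurable, but need not be Borel.\<close>

definition weighted_measure :: "(real ^ 'n \<Rightarrow> real) \<Rightarrow> (real ^ 'n) measure" where
  "weighted_measure \<phi> = density lebesgue (\<lambda>x. ennreal (\<phi> x))"

end

theory Submission
  imports Defs
begin

text \<open>
  Both inequalities reduce to statements about one convex set \<open>K\<close>, a superlevel set of \<open>f\<close>. A pair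
  \<open>(x, y)\<close> with \<open>min (f x) (f y) \<ge> t\<close> consists of two points of the superlevel set \<open>K\<close> of level \<open>t\<close>,
  so \<open>Delta \<theta> f\<close> exceeds \<open>t\<close> only on \<open>(1 - \<theta>) K - \<theta> K\<close>, and \<open>Delta_tilde f\<close> only on the convex hull of
  \<open>K\<close> and \<open>-K\<close>. Integrating over \<open>t\<close>, it suffices to bound the mass of these sets by multiples of
  the supremum \<open>G\<close> of
  the ratios \<open>\<mu> ((1 - \<theta>) y - \<theta> K) / \<theta>\<^sup>n\<close>.

  For the first bound, consider the body of all \<open>(\<theta>, x)\<close> with \<open>x \<in> (1 - \<theta>) K - \<theta> K\<close>, and on it the
  volume of the overlap \<open>(1 - \<theta>) K \<inter> (x + \<theta> K)\<close>. By Fubini's theorem the integral of the overlap is at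
  most \<open>vol K\<close> times \<open>G\<close> times the integral \<open>B\<close> of \<open>\<theta>\<^sup>n (1 - \<theta>)\<^sup>n\<close>. On the other hand the overlap is
  \<open>2\<^sup>-\<^sup>n vol K\<close> at the centre \<open>\<theta> = 1/2\<close>, \<open>x = 0\<close>, and at a point of the body contracted by \<open>1 - u\<close> towards
  the centre it is at least \<open>u\<^sup>n\<close> times as large. As the density decreases radially, the contracted body
  has at least \<open>(1 - u)\<^sup>n\<^sup>+\<^sup>1\<close> times the mass of the body, and the integral of the overlap is at least
  \<open>2\<^sup>-\<^sup>n vol K\<close> times the mass times the integral of \<open>n u\<^sup>n\<^sup>-\<^sup>1 (1 - u)\<^sup>n\<^sup>+\<^sup>1\<close>, which is \<open>(n + 1) B\<close>.
  Comparing the two gives \<open>emeasure_skew_body_le\<close> with its constant \<open>2\<^sup>n / (n + 1)\<close>.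

  The hull of \<open>K\<close> and \<open>-K\<close> is the projection of this body. If \<open>0 \<in> K\<close>, the fibre over \<open>0\<close> has length
  \<open>1\<close>, and the fibre over a point of the hull contracted by \<open>1 - u\<close> has length at least \<open>u\<close>. The same
  argument with fibre lengths in place of overlaps shows that the hull has at most \<open>n + 1\<close> times the
  mass of the body (\<open>emeasure_hull_le\<close>). Both arguments are instances of
  \<open>nn_integral_ge_of_homothetic_lower_bound\<close>.

  To stay within Borel sets, superlevel sets are replaced by their interiors; the sets lost are
  negligible because frontiers of convex sets are. For Lebesgue measure the supremum is at most the
  volume of \<open>K\<close>, and integrating that over the levels is the layer-cake formula.
\<close>

section \<open>Beta integrals and integration along homotheties\<close>

text \<open>Every point of \<open>R\<close> is at most the \<open>k\<close>-th root of \<open>Y\<close>, so \<open>R\<close> lies in an interval starting at \<open>0\<close>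
  whose total mass under the density \<open>k u\<^sup>k\<^sup>-\<^sup>1\<close> is at most \<open>Y\<close>.\<close>

lemma nn_integral_power_kernel_le:
  fixes R :: "real set" and Y :: ennreal
  assumes k: "0 < k" and R: "R \<subseteq> {0<..<1}" and Y: "\<And>u. u \<in> R \<Longrightarrow> ennreal (u ^ k) \<le> Y"
  shows "(\<integral>\<^sup>+u. ennreal (real k * u ^ (k - 1)) * indicator R u \<partial>lborel) \<le> Y"
proof (cases "R = {}")
  case True
  then show ?thesis by simp
next
  case False
  define \<rho> where "\<rho> = Sup R"
  have bdd: "bdd_above R" using R by (auto intro!: bdd_aboveI[of _ 1])
  have sub: "R \<subseteq> {0..\<rho>}" using R cSup_upper[OF _ bdd] by (force simp: \<rho>_def)
  have \<rho>: "0 \<le> \<rho>" using sub False R by fastforce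
  have "(\<integral>\<^sup>+u. ennreal (real k * u ^ (k - 1)) * indicator R u \<partial>lborel)
      \<le> (\<integral>\<^sup>+u. ennreal (real k * u ^ (k - 1)) * indicator {0..\<rho>} u \<partial>lborel)"
    using sub by (intro nn_integral_mono) (auto split: split_indicator)
  also have "\<dots> = ennreal (\<rho> ^ k - 0 ^ k)"
    by (rule nn_integral_FTC_Icc[where F = "\<lambda>u. u ^ k"])
       (auto intro!: derivative_eq_intros simp: \<rho>)
  also have "\<dots> = ennreal (\<rho> ^ k)" using k by (simp add: zero_power)
  also have "\<dots> \<le> Y"
  proof -
    obtain s where s: "\<And>n. s n \<in> R" "s \<longlonglongrightarrow> \<rho>"
      using closure_contains_Sup[OF False bdd] unfolding \<rho>_def closure_sequential by auto
    have "(\<lambda>n. ennreal (s n ^ k)) \<longlonglongrightarrow> ennreal (\<rho> ^ k)"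
      using s by (intro tendsto_intros tendsto_ennrealI)
    then show ?thesis by (rule LIMSEQ_le_const2) (use s Y in blast)
  qed
  finally show ?thesis .
qed

definition beta_integral :: "nat \<Rightarrow> nat \<Rightarrow> real" where
  "beta_integral k d = integral {0..1} (\<lambda>u. u ^ k * (1 - u) ^ d)"

lemma beta_integral_has_integral:
  "((\<lambda>u::real. u ^ k * (1 - u) ^ d) has_integral beta_integral k d) {0..1}"
  unfolding beta_integral_def
  by (intro integrable_integral integrable_continuous_real continuous_intros)

lemma nn_integral_beta_integral:
  assumes "0 \<le> c"
  shows "(\<integral>\<^sup>+u. ennreal (c * (u ^ k * (1 - u) ^ d)) * indicator {0<..<1} u \<partial>lborel)
    = ennreal (c * beta_integral k d)"
proof -
  let ?g = "\<lambda>u::real. if u \<in> {0..1} then c * (u ^ k * (1 - u) ^ d) else 0"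
  have "(?g has_integral (c * beta_integral k d)) UNIV"
    using has_integral_mult_right[OF beta_integral_has_integral[of k d], of c]
    by (subst has_integral_restrict_UNIV) simp
  moreover have "?g \<in> borel_measurable borel" by measurable
  moreover have "0 \<le> ?g x" for x using assms by auto
  ultimately have "(\<integral>\<^sup>+u. ennreal (?g u) \<partial>lborel) = ennreal (c * beta_integral k d)"
    by (intro nn_integral_has_integral_lborel) 
  moreover have "(\<integral>\<^sup>+u. ennreal (c * (u ^ k * (1 - u) ^ d)) * indicator {0<..<1} u \<partial>lborel)
      = (\<integral>\<^sup>+u. ennreal (?g u) \<partial>lborel)"
  proof (rule nn_integral_cong_AE)
    show "AE u in lborel. ennreal (c * (u ^ k * (1 - u) ^ d)) * indicator {0<..<1} u = ennreal (?g u)"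
      using AE_lborel_singleton[of 0] AE_lborel_singleton[of 1]
      by eventually_elim (auto split: split_indicator)
  qed
  ultimately show ?thesis by simp
qed

text \<open>Integration by parts. The constant \<open>n + 1\<close> of the theorem is a ratio of two neighbouring Beta
  integrals and comes from this recursion.\<close>

lemma beta_integral_Suc:
  "real (Suc k) * beta_integral k (Suc d) = real (Suc d) * beta_integral (Suc k) d"
proof -
  let ?h = "\<lambda>u::real. real (Suc k) * (u ^ k * (1 - u) ^ Suc d) - real (Suc d) * (u ^ Suc k * (1 - u) ^ d)"
  have "(?h has_integral (1 ^ Suc k * (1 - 1) ^ Suc d - 0 ^ Suc k * (1 - 0) ^ Suc d)) {0..1::real}"
    by (rule fundamental_theorem_of_calculus[where f = "\<lambda>u::real. u ^ Suc k * (1 - u) ^ Suc d"])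
       (auto intro!: derivative_eq_intros simp: has_real_derivative_iff_has_vector_derivative[symmetric]
         simp del: power_Suc of_nat_Suc)
  moreover have "(?h has_integral (real (Suc k) * beta_integral k (Suc d) - real (Suc d) * beta_integral (Suc k) d)) {0..1}"
    by (intro has_integral_diff has_integral_mult_right beta_integral_has_integral)
  ultimately have "1 ^ Suc k * (1 - 1) ^ Suc d - 0 ^ Suc k * (1 - 0) ^ Suc d = real (Suc k) * beta_integral k (Suc d) - real (Suc d) * beta_integral (Suc k) d"
    by (rule has_integral_unique)
  then show ?thesis by simp
qed

lemma beta_integral_0: "beta_integral 0 d = 1 / real (Suc d)"
proof -
  have "((\<lambda>u::real. (1 - u) ^ d) has_integral (- ((1 - 1) ^ Suc d / real (Suc d)) - (- ((1 - 0) ^ Suc d / real (Suc d))))) {0..1::real}"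
    by (rule fundamental_theorem_of_calculus[where f = "\<lambda>u::real. - ((1 - u) ^ Suc d / real (Suc d))"])
       (auto intro!: derivative_eq_intros simp: has_real_derivative_iff_has_vector_derivative[symmetric]
         field_simps simp del: power_Suc of_nat_Suc)
  then show ?thesis using beta_integral_has_integral[of 0 d] by (simp add: has_integral_unique)
qed

lemma beta_integral_pos: "0 < beta_integral k d"
proof (induction k arbitrary: d)
  case 0
  show ?case by (simp add: beta_integral_0)
next
  case (Suc k)
  have "real (Suc d) * beta_integral (Suc k) d > 0"
    unfolding beta_integral_Suc[symmetric] using Suc.IH[of "Suc d"] by simp
  then show ?case by (simp add: zero_less_mult_iff)
qed

text \<open>All that is used about the density being radially decreasing is that contracting an open set towards
  the origin shrinks its mass by at most the factor by which it shrinks Lebesgue measure. Working on the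
  Borel sets keeps Fubini's theorem available: convex sets in a product are Lebesgue measurable there,
  but in general not measurable for the product of two completed sigma-algebras.\<close>

locale radial_measure = sigma_finite_measure M for M :: "'a::euclidean_space measure" +
  assumes sets_eq_borel [measurable_cong]: "sets M = sets borel"
    and emeasure_scaleR_ge: "\<And>A r. open A \<Longrightarrow> 0 < r \<Longrightarrow> r \<le> 1 \<Longrightarrow>
      ennreal (r ^ DIM('a)) * emeasure M A \<le> emeasure M ((*\<^sub>R) r ` A)"

text \<open>The property passes to one more dimension, with the exponent raised by one. This allows one and the
  same integral estimate to be applied both in \<open>\<real>\<^sup>n\<close> and in \<open>\<real> \<times> \<real>\<^sup>n\<close>.\<close>

lemma (in radial_measure) radial_measure_pair: "radial_measure (lborel \<Otimes>\<^sub>M M :: (real \<times> 'a) measure)"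
proof -
  interpret P: pair_sigma_finite "lborel :: real measure" M ..
  have sets: "sets (lborel \<Otimes>\<^sub>M M) = sets (borel :: (real \<times> 'a) measure)"
    by (simp add: borel_prod[symmetric] sets_eq_borel cong: sets_pair_measure_cong)
  show ?thesis
  proof (intro radial_measure.intro radial_measure_axioms.intro)
    show "sigma_finite_measure (lborel \<Otimes>\<^sub>M M :: (real \<times> 'a) measure)" ..
    show "sets (lborel \<Otimes>\<^sub>M M) = sets (borel :: (real \<times> 'a) measure)" by fact
  next
    fix A :: "(real \<times> 'a) set" and r :: real
    assume A: "open A" "0 < r" "r \<le> 1"
    have oA: "open ((*\<^sub>R) r ` A)" using A by (intro open_scaling) auto
    have slice: "open (Pair t -` A)" for t
      using A(1) by (intro open_vimage continuous_intros)
    have eq: "Pair (r * t) -` ((*\<^sub>R) r ` A) = (*\<^sub>R) r ` (Pair t -` A)" for t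
    proof (intro equalityI subsetI)
      fix x assume "x \<in> Pair (r * t) -` ((*\<^sub>R) r ` A)"
      then show "x \<in> (*\<^sub>R) r ` (Pair t -` A)" using A by auto
    next
      fix x assume "x \<in> (*\<^sub>R) r ` (Pair t -` A)"
      then show "x \<in> Pair (r * t) -` ((*\<^sub>R) r ` A)" 
        by (auto intro!: image_eqI)
    qed
    have mA: "(\<lambda>t. emeasure M (Pair t -` ((*\<^sub>R) r ` A))) \<in> borel_measurable borel"
      "(\<lambda>t. emeasure M (Pair t -` A)) \<in> borel_measurable borel"
      using P.measurable_emeasure_Pair1[of "(*\<^sub>R) r ` A"] P.measurable_emeasure_Pair1[of A] oA A(1)
      unfolding sets by auto
    have "ennreal (r ^ DIM(real \<times> 'a)) * emeasure (lborel \<Otimes>\<^sub>M M) A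
        = ennreal r * (\<integral>\<^sup>+t. ennreal (r ^ DIM('a)) * emeasure M (Pair t -` A) \<partial>lborel)"
    proof -
      have "emeasure (lborel \<Otimes>\<^sub>M M) A = (\<integral>\<^sup>+t. emeasure M (Pair t -` A) \<partial>lborel)"
        using A by (intro emeasure_pair_measure_alt) (unfold sets, simp)
      then show ?thesis
        using A mA(2) by (simp add: nn_integral_cmult ennreal_mult' mult.assoc)
    qed
    also have "\<dots> \<le> ennreal r * (\<integral>\<^sup>+t. emeasure M (Pair (0 + r * t) -` ((*\<^sub>R) r ` A)) \<partial>lborel)"
      unfolding add_0 eq by (intro mult_left_mono nn_integral_mono emeasure_scaleR_ge slice A) auto
    also have "\<dots> = (\<integral>\<^sup>+t. emeasure M (Pair t -` ((*\<^sub>R) r ` A)) \<partial>lborel)"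
      using A mA by (subst (2) nn_integral_real_affine[where c = r and t = 0]) auto
    also have "\<dots> = emeasure (lborel \<Otimes>\<^sub>M M) ((*\<^sub>R) r ` A)"
      using oA by (intro emeasure_pair_measure_alt[symmetric]) (unfold sets, simp)
    finally show "ennreal (r ^ DIM(real \<times> 'a)) * emeasure (lborel \<Otimes>\<^sub>M M) A \<le> emeasure (lborel \<Otimes>\<^sub>M M) ((*\<^sub>R) r ` A)" .
  qed
qed

text \<open>The engine behind both inequalities. If \<open>A\<close> is star-shaped about the origin, the hypothesis says that
  \<open>F\<close> dominates \<open>c\<close> times the \<open>k\<close>-th power of one minus the gauge of \<open>A\<close>. In any case \<open>F x\<close> is at
  least \<open>c\<close> times the integral of \<open>k u\<^sup>k\<^sup>-\<^sup>1\<close> over those \<open>u\<close> for which \<open>x\<close> lies in \<open>(1 - u) A\<close>.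
  Exchanging the integrals leaves the masses of the contracted sets \<open>(1 - u) A\<close>, which are bounded
  below by the scaling property.\<close>

lemma (in radial_measure) nn_integral_ge_of_homothetic_lower_bound:
  fixes A :: "'a set" and F :: "'a \<Rightarrow> ennreal" and c :: real
  assumes A: "open A" and k: "0 < k" and c: "0 < c"
    and F: "\<And>u x. 0 < u \<Longrightarrow> u < 1 \<Longrightarrow> x \<in> (*\<^sub>R) (1 - u) ` A \<Longrightarrow> ennreal (c * u ^ k) \<le> F x"
  shows "ennreal (c * (real k * beta_integral (k - 1) DIM('a))) * emeasure M A \<le> (\<integral>\<^sup>+x. F x \<partial>M)"
proof -
  interpret P: pair_sigma_finite M "lborel :: real measure" ..
  define T where "T = {(x, u). 0 < u \<and> u < 1 \<and> (1 / (1 - u)) *\<^sub>R x \<in> A}"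
  have T_iff: "(x, u) \<in> T \<longleftrightarrow> 0 < u \<and> u < 1 \<and> x \<in> (*\<^sub>R) (1 - u) ` A" for x u
    by (force simp: T_def)
  have "T = (UNIV \<times> {0<..<1}) \<inter> (\<lambda>(x, u). (1 / (1 - u)) *\<^sub>R x) -` A"
    by (auto simp: T_def)
  also have "open \<dots>"
    using A by (intro continuous_open_preimage)
      (auto simp: case_prod_unfold open_Times intro!: continuous_intros)
  finally have "open T" .
  moreover have "sets (M \<Otimes>\<^sub>M lborel) = sets (borel :: ('a \<times> real) measure)"
    by (simp add: borel_prod[symmetric] sets_eq_borel cong: sets_pair_measure_cong)
  ultimately have [measurable]: "T \<in> sets (M \<Otimes>\<^sub>M lborel)" by simp
  have T_slice: "Pair x -` T \<in> sets borel" for x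
    using sets_Pair1[OF \<open>T \<in> sets (M \<Otimes>\<^sub>M lborel)\<close>] by simp
  have scaled: "open ((*\<^sub>R) (1 - u) ` A)" if "u < 1" for u
    using A that by (intro open_scaling) auto
  let ?w = "\<lambda>u. ennreal (c * (real k * u ^ (k - 1)))"
  have "ennreal (c * (real k * beta_integral (k - 1) DIM('a))) * emeasure M A
      = (\<integral>\<^sup>+u. ennreal (c * real k * (u ^ (k - 1) * (1 - u) ^ DIM('a))) * indicator {0<..<1} u \<partial>lborel) * emeasure M A"
    using c by (subst nn_integral_beta_integral) (auto simp: mult.assoc)
  also have "\<dots> = (\<integral>\<^sup>+u. ennreal (c * real k * (u ^ (k - 1) * (1 - u) ^ DIM('a))) * indicator {0<..<1} u * emeasure M A \<partial>lborel)"
    by (subst nn_integral_multc) auto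
  also have "\<dots> \<le> (\<integral>\<^sup>+u. (\<integral>\<^sup>+x. ?w u * indicator T (x, u) \<partial>M) \<partial>lborel)"
  proof (intro nn_integral_mono)
    fix u :: real
    show "ennreal (c * real k * (u ^ (k - 1) * (1 - u) ^ DIM('a))) * indicator {0<..<1} u * emeasure M A
       \<le> (\<integral>\<^sup>+x. ?w u * indicator T (x, u) \<partial>M)"
    proof (cases "0 < u \<and> u < 1")
      case True
      have "ennreal (c * real k * (u ^ (k - 1) * (1 - u) ^ DIM('a))) * indicator {0<..<1} u * emeasure M A
          = ?w u * (ennreal ((1 - u) ^ DIM('a)) * emeasure M A)"
        using True c by (simp add: ennreal_mult'[symmetric] mult.assoc[symmetric])
      also have "\<dots> \<le> ?w u * emeasure M ((*\<^sub>R) (1 - u) ` A)"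
        using True A by (intro mult_left_mono emeasure_scaleR_ge) auto
      also have "\<dots> = (\<integral>\<^sup>+x. ?w u * indicator ((*\<^sub>R) (1 - u) ` A) x \<partial>M)"
        using True scaled[of u] by (subst nn_integral_cmult_indicator) (auto simp: sets_eq_borel)
      also have "\<dots> = (\<integral>\<^sup>+x. ?w u * indicator T (x, u) \<partial>M)"
        using True by (intro nn_integral_cong) (auto simp: T_iff split: split_indicator)
      finally show ?thesis .
    qed (auto split: split_indicator)
  qed
  also have "\<dots> = (\<integral>\<^sup>+x. (\<integral>\<^sup>+u. ?w u * indicator T (x, u) \<partial>lborel) \<partial>M)"
    by (intro P.Fubini') simp
  also have "\<dots> \<le> (\<integral>\<^sup>+x. F x \<partial>M)"
  proof (intro nn_integral_mono)
    fix x
    have "(\<integral>\<^sup>+u. ?w u * indicator T (x, u) \<partial>lborel)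
        = (\<integral>\<^sup>+u. ennreal c * (ennreal (real k * u ^ (k - 1)) * indicator (Pair x -` T) u) \<partial>lborel)"
      using c by (intro nn_integral_cong) (auto simp: ennreal_mult' split: split_indicator)
    also have "\<dots> = ennreal c * (\<integral>\<^sup>+u. ennreal (real k * u ^ (k - 1)) * indicator (Pair x -` T) u \<partial>lborel)"
      using T_slice by (subst nn_integral_cmult) auto
    also have "\<dots> \<le> ennreal c * (F x / ennreal c)"
    proof (intro mult_left_mono nn_integral_power_kernel_le k)
      show "Pair x -` T \<subseteq> {0<..<1}" by (auto simp: T_def)
      fix u assume "u \<in> Pair x -` T"
      then have "ennreal c * ennreal (u ^ k) \<le> F x"
        using F[of u x] c by (auto simp: T_iff ennreal_mult'[symmetric])
      then show "ennreal (u ^ k) \<le> F x / ennreal c"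
        using c divide_right_mono_ennreal[of "ennreal c * ennreal (u ^ k)" "F x" "ennreal c"]
          mult_divide_eq_ennreal[of "ennreal c" "ennreal (u ^ k)"] by (simp add: mult.commute)
    qed simp
    also have "\<dots> = F x"
      using c mult_divide_eq_ennreal[of "ennreal c" "F x"]
      by (simp add: ennreal_times_divide mult.commute[of "ennreal c"])
    finally show "(\<integral>\<^sup>+u. ?w u * indicator T (x, u) \<partial>lborel) \<le> F x" .
  qed
  finally show ?thesis .
qed

section \<open>The body swept out by the skew differences\<close>

definition skew_difference :: "'a::real_vector set \<Rightarrow> real \<Rightarrow> 'a set" where
  "skew_difference K \<theta> = (\<lambda>(a, b). (1 - \<theta>) *\<^sub>R a - \<theta> *\<^sub>R b) ` (K \<times> K)"

text \<open>For convex \<open>K\<close> this is the convex hull of a copy of \<open>K\<close> and a copy of \<open>-K\<close> placed at heights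
  \<open>-1/2\<close> and \<open>1/2\<close>, without its two end faces. The parameter is shifted to \<open>t = \<theta> - 1/2\<close> so that the
  centre of the homotheties, which lies at \<open>\<theta> = 1/2\<close>, becomes the origin; dropping the end faces makes
  the body open whenever \<open>K\<close> is.\<close>

definition skew_body :: "'a::real_vector set \<Rightarrow> (real \<times> 'a) set" where
  "skew_body K = {(t, x). \<bar>t\<bar> < 1 / 2 \<and> x \<in> skew_difference K (1 / 2 + t)}"

lemma mem_skew_difference_iff:
  assumes "\<theta> < 1"
  shows "x \<in> skew_difference K \<theta> \<longleftrightarrow> (\<exists>b\<in>K. (1 / (1 - \<theta>)) *\<^sub>R (x + \<theta> *\<^sub>R b) \<in> K)"
proof
  assume "x \<in> skew_difference K \<theta>"
  then obtain a b where "a \<in> K" "b \<in> K" "x = (1 - \<theta>) *\<^sub>R a - \<theta> *\<^sub>R b"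
    by (auto simp: skew_difference_def)
  then show "\<exists>b\<in>K. (1 / (1 - \<theta>)) *\<^sub>R (x + \<theta> *\<^sub>R b) \<in> K"
    using assms by (intro bexI[of _ b]) auto
next
  assume "\<exists>b\<in>K. (1 / (1 - \<theta>)) *\<^sub>R (x + \<theta> *\<^sub>R b) \<in> K"
  then obtain b where b: "b \<in> K" "(1 / (1 - \<theta>)) *\<^sub>R (x + \<theta> *\<^sub>R b) \<in> K" by blast
  then show "x \<in> skew_difference K \<theta>"
    unfolding skew_difference_def using assms
    by (intro image_eqI[of _ _ "((1 / (1 - \<theta>)) *\<^sub>R (x + \<theta> *\<^sub>R b), b)"]) auto
qed

lemma skew_difference_mono: "K \<subseteq> L \<Longrightarrow> skew_difference K \<theta> \<subseteq> skew_difference L \<theta>"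
  by (auto simp: skew_difference_def)

lemma skew_body_mono: "K \<subseteq> L \<Longrightarrow> skew_body K \<subseteq> skew_body L"
  using skew_difference_mono[of K L] by (auto simp: skew_body_def)

lemma open_skew_body:
  fixes U :: "'a::real_normed_vector set"
  assumes "open U"
  shows "open (skew_body U)"
proof -
  have "skew_body U = (\<Union>b\<in>U. ({- (1 / 2) <..< 1 / 2} \<times> UNIV) \<inter>
      (\<lambda>(t, x). (1 / (1 / 2 - t)) *\<^sub>R (x + (1 / 2 + t) *\<^sub>R b)) -` U)"
    by (auto simp: skew_body_def mem_skew_difference_iff)
  also have "open \<dots>"
    using assms by (intro open_UN ballI continuous_open_preimage)
      (auto simp: case_prod_unfold open_Times intro!: continuous_intros)
  finally show ?thesis .
qed

lemma convex_skew_difference: "convex K \<Longrightarrow> convex (skew_difference K \<theta>)"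
  unfolding skew_difference_def
  by (intro convex_linear_image convex_Times linearI) (auto simp: algebra_simps)

lemma convex_combination_of_members:
  assumes "convex K" "a \<in> K" "b \<in> K" "0 \<le> p" "0 \<le> q" "0 < p + q"
  obtains c where "c \<in> K" "p *\<^sub>R a + q *\<^sub>R b = (p + q) *\<^sub>R c"
proof
  show "(p / (p + q)) *\<^sub>R a + (q / (p + q)) *\<^sub>R b \<in> K"
    using assms by (intro convexD) (auto simp: add_divide_distrib[symmetric])
  show "p *\<^sub>R a + q *\<^sub>R b = (p + q) *\<^sub>R ((p / (p + q)) *\<^sub>R a + (q / (p + q)) *\<^sub>R b)"
    using assms by (simp add: scaleR_add_right)
qed

lemma mem_affine_image_iff:
  fixes U :: "'a::real_vector set"
  assumes "r \<noteq> 0"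
  shows "z \<in> (\<lambda>s. r *\<^sub>R s + d) ` U \<longleftrightarrow> (1 / r) *\<^sub>R (z - d) \<in> U"
    "z \<in> (*\<^sub>R) r ` U \<longleftrightarrow> (1 / r) *\<^sub>R z \<in> U"
    "z \<in> (\<lambda>s. d - r *\<^sub>R s) ` U \<longleftrightarrow> (1 / r) *\<^sub>R (d - z) \<in> U"
  using assms by (auto intro: image_eqI[of z _ "(1 / r) *\<^sub>R (z - d)"]
    image_eqI[of z _ "(1 / r) *\<^sub>R z"] image_eqI[of z _ "(1 / r) *\<^sub>R (d - z)"])

lemma emeasure_lborel_affine_image:
  fixes U :: "'a::euclidean_space set"
  assumes "open U" "0 < r"
  shows "open ((\<lambda>x. r *\<^sub>R x + d) ` U)"
    "emeasure lborel ((\<lambda>x. r *\<^sub>R x + d) ` U) = ennreal (r ^ DIM('a)) * emeasure lborel U"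
proof -
  have "open ((+) d ` ((*\<^sub>R) r ` U))"
    using assms by (intro open_translation open_scaling) auto
  also have "(+) d ` ((*\<^sub>R) r ` U) = (\<lambda>x. r *\<^sub>R x + d) ` U"
    by (simp add: image_image add.commute)
  finally show op: "open ((\<lambda>x. r *\<^sub>R x + d) ` U)" .
  show "emeasure lborel ((\<lambda>x. r *\<^sub>R x + d) ` U) = ennreal (r ^ DIM('a)) * emeasure lborel U"
    using emeasure_lebesgue_affine[of r d U] op assms by simp
qed

text \<open>The overlap \<open>(1 - \<theta>) U \<inter> (x + \<theta> U)\<close> is largest at the centre, where it equals \<open>U / 2\<close>. At a point
  of the body contracted by \<open>1 - u\<close> it still contains a translate of \<open>(u / 2) U\<close>, because a convex
  combination of a point of \<open>U\<close> with a varying point of \<open>U\<close> stays in \<open>U\<close>.\<close>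

lemma overlap_lower_bound:
  fixes U :: "'a::euclidean_space set"
  assumes U: "open U" "convex U"
    and u: "0 < u" "u < 1" and p: "(t, x) \<in> (*\<^sub>R) (1 - u) ` skew_body U"
  shows "\<bar>t\<bar> < 1 / 2"
    "ennreal ((u / 2) ^ DIM('a)) * emeasure lborel U
      \<le> emeasure lborel ((*\<^sub>R) (1 / 2 - t) ` U \<inter> (\<lambda>s. (1 / 2 + t) *\<^sub>R s + x) ` U)"
proof -
  from p obtain t' a b where t': "\<bar>t'\<bar> < 1 / 2" and ab: "a \<in> U" "b \<in> U"
    and t: "t = (1 - u) * t'"
    and x: "x = (1 - u) *\<^sub>R ((1 / 2 - t') *\<^sub>R a - (1 / 2 + t') *\<^sub>R b)"
    by (auto simp: skew_body_def skew_difference_def)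
  have "\<bar>t\<bar> = (1 - u) * \<bar>t'\<bar>" using u by (simp add: t abs_mult)
  also have "\<dots> \<le> 1 * \<bar>t'\<bar>" using u by (intro mult_right_mono) auto
  finally show lt: "\<bar>t\<bar> < 1 / 2" using t' by simp
  define d where "d = ((1 - u) * (1 / 2 - t')) *\<^sub>R a"
  have "(\<lambda>s. (u / 2) *\<^sub>R s + d) ` U \<subseteq> (*\<^sub>R) (1 / 2 - t) ` U \<inter> (\<lambda>s. (1 / 2 + t) *\<^sub>R s + x) ` U"
  proof (intro image_subsetI IntI)
    fix s assume s: "s \<in> U"
    have pos: "0 \<le> (1 - u) * (1 / 2 - t')" "0 \<le> (1 - u) * (1 / 2 + t')" using t' u by auto
    have "0 < (1 - u) * (1 / 2 - t') + u / 2" "0 < (1 - u) * (1 / 2 + t') + u / 2"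
      using pos u by linarith+
    moreover have e: "(1 - u) * (1 / 2 - t') + u / 2 = 1 / 2 - t"
        "(1 - u) * (1 / 2 + t') + u / 2 = 1 / 2 + t"
      by (simp_all add: t field_simps)
    moreover obtain c where "c \<in> U" "((1 - u) * (1 / 2 - t')) *\<^sub>R a + (u / 2) *\<^sub>R s
        = ((1 - u) * (1 / 2 - t') + u / 2) *\<^sub>R c"
      using convex_combination_of_members[OF U(2) ab(1) s, of "(1 - u) * (1 / 2 - t')" "u / 2"] pos u calculation
      by auto
    ultimately show "(u / 2) *\<^sub>R s + d \<in> (*\<^sub>R) (1 / 2 - t) ` U"
      by (metis add.commute d_def image_eqI)
    obtain c where "c \<in> U" "((1 - u) * (1 / 2 + t')) *\<^sub>R b + (u / 2) *\<^sub>R s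
        = (1 / 2 + t) *\<^sub>R c"
      using convex_combination_of_members[OF U(2) ab(2) s, of "(1 - u) * (1 / 2 + t')" "u / 2"] pos u e lt
      by (metis abs_less_iff add.inverse_inverse divide_pos_pos less_eq_real_def less_iff_diff_less_0 linorder_not_le zero_less_numeral add_nonneg_pos)
    moreover have "(u / 2) *\<^sub>R s + d = ((1 - u) * (1 / 2 + t')) *\<^sub>R b + (u / 2) *\<^sub>R s + x"
      by (simp add: d_def x algebra_simps)
    ultimately show "(u / 2) *\<^sub>R s + d \<in> (\<lambda>s. (1 / 2 + t) *\<^sub>R s + x) ` U"
      by auto
  qed
  moreover have "open ((*\<^sub>R) (1 / 2 - t) ` U)" "open ((\<lambda>s. (1 / 2 + t) *\<^sub>R s + x) ` U)"
    using lt U emeasure_lborel_affine_image(1)[of U "1 / 2 + t" x] by (auto intro!: open_scaling)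
  ultimately have "emeasure lborel ((\<lambda>s. (u / 2) *\<^sub>R s + d) ` U)
      \<le> emeasure lborel ((*\<^sub>R) (1 / 2 - t) ` U \<inter> (\<lambda>s. (1 / 2 + t) *\<^sub>R s + x) ` U)"
    by (intro emeasure_mono) auto
  then show "ennreal ((u / 2) ^ DIM('a)) * emeasure lborel U
      \<le> emeasure lborel ((*\<^sub>R) (1 / 2 - t) ` U \<inter> (\<lambda>s. (1 / 2 + t) *\<^sub>R s + x) ` U)"
    using emeasure_lborel_affine_image(2)[of U "u / 2" d] U u by simp
qed

context radial_measure
begin

text \<open>Fubini's theorem in the pair \<open>(x, z)\<close>: for fixed \<open>z = (1 - \<theta>) y\<close> with \<open>y \<in> U\<close>, the points \<open>x\<close> whose overlap
  contains \<open>z\<close> form exactly the set \<open>(1 - \<theta>) y - \<theta> U\<close> that occurs in the hypothesis.\<close>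

lemma overlap_slice_integral_le:
  fixes U :: "'a set"
  assumes U: "open U" and \<theta>: "0 < \<theta>" "\<theta> < 1"
    and G: "\<And>y. y \<in> U \<Longrightarrow>
      emeasure M ((\<lambda>s. (1 - \<theta>) *\<^sub>R y - \<theta> *\<^sub>R s) ` U) \<le> ennreal (\<theta> ^ DIM('a)) * G"
  shows "(\<integral>\<^sup>+x. emeasure lborel ((*\<^sub>R) (1 - \<theta>) ` U \<inter> (\<lambda>s. \<theta> *\<^sub>R s + x) ` U) \<partial>M)
    \<le> ennreal (\<theta> ^ DIM('a) * (1 - \<theta>) ^ DIM('a)) * (emeasure lborel U * G)"
proof -
  interpret P: pair_sigma_finite M "lborel :: 'a measure" ..
  define W where "W = {(x, z). (1 / (1 - \<theta>)) *\<^sub>R z \<in> U \<and> (1 / \<theta>) *\<^sub>R (z - x) \<in> U}"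
  have oU: "open ((*\<^sub>R) (1 - \<theta>) ` U)" using U \<theta> by (intro open_scaling) auto
  have "W = (\<lambda>(x, z). (1 / (1 - \<theta>)) *\<^sub>R z) -` U \<inter> (\<lambda>(x, z). (1 / \<theta>) *\<^sub>R (z - x)) -` U"
    by (auto simp: W_def)
  also have "open \<dots>"
    using U by (intro open_Int open_vimage) (auto simp: case_prod_unfold intro!: continuous_intros)
  finally have "open W" .
  moreover have "sets (M \<Otimes>\<^sub>M lborel) = sets (borel :: ('a \<times> 'a) measure)"
    by (simp add: borel_prod[symmetric] sets_eq_borel cong: sets_pair_measure_cong)
  ultimately have W: "W \<in> sets (M \<Otimes>\<^sub>M lborel)" by simp
  have s1: "Pair x -` W = (*\<^sub>R) (1 - \<theta>) ` U \<inter> (\<lambda>s. \<theta> *\<^sub>R s + x) ` U" for x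
    using \<theta> by (intro set_eqI) (simp add: W_def mem_affine_image_iff)
  have s2: "(\<lambda>x. (x, z)) -` W = (if z \<in> (*\<^sub>R) (1 - \<theta>) ` U then (\<lambda>s. z - \<theta> *\<^sub>R s) ` U else {})" for z
    using \<theta> by (intro set_eqI) (simp add: W_def mem_affine_image_iff)
  have "(\<integral>\<^sup>+x. emeasure lborel ((*\<^sub>R) (1 - \<theta>) ` U \<inter> (\<lambda>s. \<theta> *\<^sub>R s + x) ` U) \<partial>M)
      = emeasure (M \<Otimes>\<^sub>M lborel) W"
    unfolding s1[symmetric] using W by (subst lborel.emeasure_pair_measure_alt) auto
  also have "\<dots> = (\<integral>\<^sup>+z. emeasure M ((\<lambda>x. (x, z)) -` W) \<partial>lborel)"
    using W by (rule P.emeasure_pair_measure_alt2)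
  also have "\<dots> \<le> (\<integral>\<^sup>+z. ennreal (\<theta> ^ DIM('a)) * G * indicator ((*\<^sub>R) (1 - \<theta>) ` U) z \<partial>lborel)"
    using G by (intro nn_integral_mono) (auto simp: s2)
  also have "\<dots> = ennreal (\<theta> ^ DIM('a)) * G * emeasure lborel ((*\<^sub>R) (1 - \<theta>) ` U)"
    using oU by (intro nn_integral_cmult_indicator) auto
  also have "emeasure lborel ((*\<^sub>R) (1 - \<theta>) ` U) = ennreal ((1 - \<theta>) ^ DIM('a)) * emeasure lborel U"
    using emeasure_lborel_affine_image(2)[of U "1 - \<theta>" 0] U \<theta> by simp
  finally show ?thesis
    using \<theta> by (simp add: ennreal_mult' mult_ac)
qed

text \<open>The Rogers-Shephard bound for the skew body. The integral of the overlap volume over the body is at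
  most \<open>v B G\<close>, with \<open>v\<close> the volume of \<open>U\<close> and \<open>B\<close> the integral of \<open>\<theta>\<^sup>n (1 - \<theta>)\<^sup>n\<close>. It is at least
  \<open>2\<^sup>-\<^sup>n v (n + 1) B\<close> times the mass of the body, by the estimate along homotheties in dimension \<open>n + 1\<close>
  with \<open>k = n\<close>. Finite positive volume makes it possible to cancel \<open>v B\<close>.\<close>

lemma emeasure_skew_body_le:
  fixes U :: "'a set"
  assumes U: "open U" "convex U" and fin: "emeasure lborel U < \<infinity>"
    and G: "\<And>y \<theta>. y \<in> U \<Longrightarrow> 0 < \<theta> \<Longrightarrow> \<theta> < 1 \<Longrightarrow>
      emeasure M ((\<lambda>s. (1 - \<theta>) *\<^sub>R y - \<theta> *\<^sub>R s) ` U) \<le> ennreal (\<theta> ^ DIM('a)) * G"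
  shows "emeasure (lborel \<Otimes>\<^sub>M M) (skew_body U) \<le> ennreal (2 ^ DIM('a) / (real DIM('a) + 1)) * G"
proof (cases "U = {}")
  case True
  then show ?thesis by (simp add: skew_body_def skew_difference_def)
next
  case False
  let ?n = "DIM('a)"
  let ?P = "lborel \<Otimes>\<^sub>M M :: (real \<times> 'a) measure"
  interpret P: pair_sigma_finite "lborel :: real measure" M ..
  interpret R: radial_measure ?P by (rule radial_measure_pair)
  define v where "v = measure lborel U"
  have v: "emeasure lborel U = ennreal v"
    using fin by (auto simp: v_def emeasure_eq_ennreal_measure less_top)
  have v0: "0 < v"
  proof -
    have "emeasure lborel U \<noteq> 0"
      using False U open_not_negligible[of U] by (auto simp: negligible_iff_emeasure0)
    then show ?thesis unfolding v using not_gr_zero by fastforce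
  qed
  define B where "B = beta_integral ?n ?n"
  have B: "0 < B" by (simp add: B_def beta_integral_pos)
  have n: "0 < ?n" by simp
  have kB: "real ?n * beta_integral (?n - 1) DIM(real \<times> 'a) = (real ?n + 1) * B"
    using beta_integral_Suc[of "?n - 1" "?n"] n by (simp add: B_def add.commute)
  \<comment> \<open>The set \<open>Z\<close> has the overlaps as slices, which makes their volume a measurable function of \<open>(t, x)\<close>.\<close>
  define Z :: "((real \<times> 'a) \<times> 'a) set" where "Z = {((t, x), z). \<bar>t\<bar> < 1 / 2 \<and>
    (1 / (1 / 2 - t)) *\<^sub>R z \<in> U \<and> (1 / (1 / 2 + t)) *\<^sub>R (z - x) \<in> U}"
  have "Z = (({- (1 / 2) <..< 1 / 2} \<times> UNIV) \<times> UNIV \<inter> (\<lambda>((t, x), z). (1 / (1 / 2 - t)) *\<^sub>R z) -` U)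
      \<inter> (({- (1 / 2) <..< 1 / 2} \<times> UNIV) \<times> UNIV \<inter> (\<lambda>((t, x), z). (1 / (1 / 2 + t)) *\<^sub>R (z - x)) -` U)"
    by (auto simp: Z_def)
  also have "open \<dots>"
    using U by (intro open_Int continuous_open_preimage)
      (auto simp: case_prod_unfold open_Times intro!: continuous_intros)
  finally have "open Z" .
  moreover have "sets (?P \<Otimes>\<^sub>M lborel) = sets (borel :: ((real \<times> 'a) \<times> 'a) measure)"
    by (simp add: borel_prod[symmetric] R.sets_eq_borel sets_eq_borel cong: sets_pair_measure_cong)
  ultimately have Z: "Z \<in> sets (?P \<Otimes>\<^sub>M lborel)" by simp
  define ov where "ov = (\<lambda>p. emeasure lborel (Pair p -` Z))"
  have ov_meas: "ov \<in> borel_measurable ?P"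
    unfolding ov_def using Z by (rule lborel.measurable_emeasure_Pair)
  have ov: "ov (t, x) = (if \<bar>t\<bar> < 1 / 2 then
    emeasure lborel ((*\<^sub>R) (1 / 2 - t) ` U \<inter> (\<lambda>s. (1 / 2 + t) *\<^sub>R s + x) ` U) else 0)" for t x
  proof (cases "\<bar>t\<bar> < 1 / 2")
    case True
    then have t: "0 < 1 / 2 - t" "0 < 1 / 2 + t" by auto
    have "Pair (t, x) -` Z = (*\<^sub>R) (1 / 2 - t) ` U \<inter> (\<lambda>s. (1 / 2 + t) *\<^sub>R s + x) ` U"
      using t True by (intro set_eqI) (simp add: Z_def mem_affine_image_iff)
    with True show ?thesis by (simp add: ov_def)
  qed (simp add: ov_def Z_def vimage_def)
  have "ennreal (v / 2 ^ ?n * ((real ?n + 1) * B)) * emeasure ?P (skew_body U) \<le> (\<integral>\<^sup>+p. ov p \<partial>?P)"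
    unfolding kB[symmetric]
  proof (rule R.nn_integral_ge_of_homothetic_lower_bound)
    show "open (skew_body U)" using U by (intro open_skew_body)
    show "0 < v / 2 ^ ?n" using v0 by simp
    fix u p assume u: "0 < u" "u < 1" and p: "p \<in> (*\<^sub>R) (1 - u) ` skew_body U"
    obtain t x where tx: "p = (t, x)" by (cases p)
    show "ennreal (v / 2 ^ ?n * u ^ ?n) \<le> ov p"
      using overlap_lower_bound[OF U u, of t x] p v0 u unfolding tx ov
      by (simp add: v ennreal_mult'[symmetric] power_divide mult.commute)
  qed (use n in auto)
  also have "(\<integral>\<^sup>+p. ov p \<partial>?P) \<le> ennreal (v * B) * G"
  proof -
    have "(\<integral>\<^sup>+p. ov p \<partial>?P) = (\<integral>\<^sup>+t. (\<integral>\<^sup>+x. ov (t, x) \<partial>M) \<partial>lborel)"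
      using ov_meas by (rule nn_integral_fst[symmetric])
    also have "\<dots> \<le> (\<integral>\<^sup>+t. ennreal (1 * ((1 / 2 + t) ^ ?n * (1 - (1 / 2 + t)) ^ ?n)) * indicator {0<..<1} (1 / 2 + t)
        * (ennreal v * G) \<partial>lborel)"
    proof (intro nn_integral_mono)
      fix t :: real
      show "(\<integral>\<^sup>+x. ov (t, x) \<partial>M) \<le> ennreal (1 * ((1 / 2 + t) ^ ?n * (1 - (1 / 2 + t)) ^ ?n))
          * indicator {0<..<1} (1 / 2 + t) * (ennreal v * G)"
      proof (cases "\<bar>t\<bar> < 1 / 2")
        case True
        then have "0 < 1 / 2 + t" "1 / 2 + t < 1" "1 - (1 / 2 + t) = 1 / 2 - t" by auto
        then show ?thesis
          using overlap_slice_integral_le[OF U(1) _ _ G, of "1 / 2 + t"] True by (simp add: ov v)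
      qed (simp add: ov)
    qed
    also have "\<dots> = (\<integral>\<^sup>+\<theta>. ennreal (1 * (\<theta> ^ ?n * (1 - \<theta>) ^ ?n)) * indicator {0<..<1} \<theta> * (ennreal v * G) \<partial>lborel)"
      using nn_integral_real_affine[of "\<lambda>\<theta>. ennreal (1 * (\<theta> ^ ?n * (1 - \<theta>) ^ ?n)) * indicator {0<..<1} \<theta> * (ennreal v * G)" 1 "1 / 2"]
      by simp
    also have "\<dots> = (\<integral>\<^sup>+\<theta>. ennreal (1 * (\<theta> ^ ?n * (1 - \<theta>) ^ ?n)) * indicator {0<..<1} \<theta> \<partial>lborel) * (ennreal v * G)"
      by (rule nn_integral_multc) simp
    also have "\<dots> = ennreal (v * B) * G"
      using v0 B by (subst nn_integral_beta_integral) (auto simp: B_def ennreal_mult' mult_ac)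
    finally show ?thesis .
  qed
  finally have le: "ennreal (v / 2 ^ ?n * ((real ?n + 1) * B)) * emeasure ?P (skew_body U) \<le> ennreal (v * B) * G" .
  let ?c = "2 ^ ?n / ((real ?n + 1) * (v * B))"
  have c: "0 \<le> ?c" using v0 B by simp
  have "emeasure ?P (skew_body U)
      = ennreal (?c * (v / 2 ^ ?n * ((real ?n + 1) * B))) * emeasure ?P (skew_body U)"
    using v0 B by (simp add: add_eq_0_iff)
  also have "\<dots> = ennreal ?c * (ennreal (v / 2 ^ ?n * ((real ?n + 1) * B)) * emeasure ?P (skew_body U))"
    by (subst ennreal_mult'[OF c]) (simp add: mult.assoc)
  also have "\<dots> \<le> ennreal ?c * (ennreal (v * B) * G)"
    by (intro mult_left_mono le) simp
  also have "\<dots> = ennreal (?c * (v * B)) * G"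
    by (subst ennreal_mult'[OF c]) (simp add: mult.assoc)
  also have "?c * (v * B) = 2 ^ ?n / (real ?n + 1)"
    using v0 B by simp
  finally show ?thesis .
qed

end

section \<open>Convex hulls of a set and its reflection\<close>

lemma scaleR_mem_of_zero_in_closure:
  fixes U :: "'a::euclidean_space set"
  assumes "open U" "convex U" "0 \<in> closure U" "a \<in> U" "0 < r" "r \<le> 1"
  shows "r *\<^sub>R a \<in> U"
  using mem_interior_closure_convex_shrink[of U a 0 r] assms by (simp add: interior_open)

text \<open>The end parameters \<open>\<theta> = 0\<close> and \<open>\<theta> = 1\<close> may be excluded because \<open>U\<close> is open: a point \<open>y \<in> U\<close> is
  \<open>(1 - \<theta>) a - \<theta> y\<close> for a slightly stretched copy \<open>a\<close> of \<open>y\<close>, and symmetrically for \<open>-y\<close>.\<close>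

lemma convex_hull_Un_uminus_subset_skew_difference:
  fixes U :: "'a::euclidean_space set"
  assumes U: "open U" "convex U"
  shows "convex hull (U \<union> uminus ` U) \<subseteq> (\<Union>\<theta>\<in>{0<..<1}. skew_difference U \<theta>)" (is "_ \<subseteq> ?W")
proof (rule hull_minimal)
  have stretch: "\<exists>\<theta>. 0 < \<theta> \<and> \<theta> < 1 \<and> ((1 + \<theta>) / (1 - \<theta>)) *\<^sub>R y \<in> U" if y: "y \<in> U" for y
  proof -
    obtain e where e: "0 < e" "ball y e \<subseteq> U"
      using openE[OF U(1) y] by metis
    define N where "N = norm y + 1"
    have N: "0 < N" by (simp add: N_def add_nonneg_pos)
    define d where "d = e / (2 * N)"
    have d: "0 < d" using e N by (simp add: d_def)
    define \<theta> where "\<theta> = d / (2 + d)"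
    have \<theta>: "0 < \<theta>" "\<theta> < 1" using d by (auto simp: \<theta>_def)
    have t: "\<theta> * (2 + d) = d" using d by (simp add: \<theta>_def)
    have "1 + \<theta> = (1 + d) * (1 - \<theta>)" using t by (simp add: algebra_simps)
    then have q: "(1 + \<theta>) / (1 - \<theta>) = 1 + d" using \<theta> by simp
    have "norm (d *\<^sub>R y) < e"
    proof -
      have "d * norm y \<le> d * N" using d by (simp add: N_def)
      also have "d * N = e / 2" using N by (simp add: d_def)
      finally show ?thesis using e d by simp
    qed
    then have "(1 + d) *\<^sub>R y \<in> ball y e" by (simp add: dist_norm scaleR_add_left)
    then have "(1 + d) *\<^sub>R y \<in> U" using e(2) by (rule subsetD[rotated])
    then show ?thesis using \<theta> q by (intro exI[of _ \<theta>]) simp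
  qed
  show "U \<union> uminus ` U \<subseteq> ?W"
  proof (intro Un_least image_subsetI subsetI)
    fix y assume y: "y \<in> U"
    obtain \<theta> where \<theta>: "0 < \<theta>" "\<theta> < 1" "((1 + \<theta>) / (1 - \<theta>)) *\<^sub>R y \<in> U" using stretch[OF y] by blast
    have e: "(1 - \<theta>) *\<^sub>R (((1 + \<theta>) / (1 - \<theta>)) *\<^sub>R y) = y + \<theta> *\<^sub>R y"
      using \<theta> by (simp add: scaleR_add_left)
    have "y = (1 - \<theta>) *\<^sub>R (((1 + \<theta>) / (1 - \<theta>)) *\<^sub>R y) - \<theta> *\<^sub>R y"
      unfolding e by simp
    then have "y \<in> skew_difference U \<theta>"
      unfolding skew_difference_def using \<theta>(3) y
      by (intro image_eqI[of _ _ "(((1 + \<theta>) / (1 - \<theta>)) *\<^sub>R y, y)"]) simp_all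
    then show "y \<in> ?W" using \<theta> by auto
    have "- y = (1 - (1 - \<theta>)) *\<^sub>R y - (1 - \<theta>) *\<^sub>R (((1 + \<theta>) / (1 - \<theta>)) *\<^sub>R y)"
      unfolding e by simp
    then have "- y \<in> skew_difference U (1 - \<theta>)"
      unfolding skew_difference_def using \<theta>(3) y
      by (intro image_eqI[of _ _ "(y, ((1 + \<theta>) / (1 - \<theta>)) *\<^sub>R y)"]) simp_all
    then show "- y \<in> ?W" using \<theta> by (intro UN_I[of "1 - \<theta>"]) auto
  qed
  show "convex ?W"
  proof (rule convexI)
    fix x y p q assume x: "x \<in> ?W" and y: "y \<in> ?W" and pq: "0 \<le> p" "0 \<le> q" "p + q = (1::real)"
    from x obtain \<theta> a b where \<theta>: "0 < \<theta>" "\<theta> < 1" and ab: "a \<in> U" "b \<in> U" and x: "x = (1 - \<theta>) *\<^sub>R a - \<theta> *\<^sub>R b"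
      by (auto simp: skew_difference_def)
    from y obtain \<eta> a' b' where \<eta>: "0 < \<eta>" "\<eta> < 1" and ab': "a' \<in> U" "b' \<in> U" and y: "y = (1 - \<eta>) *\<^sub>R a' - \<eta> *\<^sub>R b'"
      by (auto simp: skew_difference_def)
    define \<tau> where "\<tau> = p * \<theta> + q * \<eta>"
    have \<tau>': "p * (1 - \<theta>) + q * (1 - \<eta>) = 1 - \<tau>" using pq by (simp add: \<tau>_def algebra_simps)
    have nn: "0 \<le> p * \<theta>" "0 \<le> q * \<eta>" "0 \<le> p * (1 - \<theta>)" "0 \<le> q * (1 - \<eta>)" using pq \<theta> \<eta> by auto
    have \<tau>: "0 < \<tau>" "0 < 1 - \<tau>"
    proof -
      have "0 < p * s + q * t" if "0 < s" "0 < t" for s t :: real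
        using pq that by (cases "p = 0") (simp_all add: add_pos_nonneg)
      from this[OF \<theta>(1) \<eta>(1)] this[of "1 - \<theta>" "1 - \<eta>"]
      show "0 < \<tau>" "0 < 1 - \<tau>" using \<theta> \<eta> unfolding \<tau>'[symmetric] by (simp_all add: \<tau>_def)
    qed
    obtain c where c: "c \<in> U" "(p * (1 - \<theta>)) *\<^sub>R a + (q * (1 - \<eta>)) *\<^sub>R a' = (1 - \<tau>) *\<^sub>R c"
      using convex_combination_of_members[OF U(2) ab(1) ab'(1) nn(3,4)] \<tau>(2) unfolding \<tau>' by blast
    obtain d where d: "d \<in> U" "(p * \<theta>) *\<^sub>R b + (q * \<eta>) *\<^sub>R b' = \<tau> *\<^sub>R d"
      using convex_combination_of_members[OF U(2) ab(2) ab'(2) nn(1,2)] \<tau>(1) unfolding \<tau>_def by blast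
    have "p *\<^sub>R x + q *\<^sub>R y = ((p * (1 - \<theta>)) *\<^sub>R a + (q * (1 - \<eta>)) *\<^sub>R a') - ((p * \<theta>) *\<^sub>R b + (q * \<eta>) *\<^sub>R b')"
      by (simp add: x y scaleR_diff_right)
    also have "\<dots> = (1 - \<tau>) *\<^sub>R c - \<tau> *\<^sub>R d" by (simp only: c d)
    finally have "p *\<^sub>R x + q *\<^sub>R y \<in> skew_difference U \<tau>"
      using c d by (auto simp: skew_difference_def)
    then show "p *\<^sub>R x + q *\<^sub>R y \<in> ?W" using \<tau> by auto
  qed
qed

text \<open>The fibre of the skew body over \<open>x\<close> is the set of heights at which \<open>x\<close> occurs. Over the origin it has
  length \<open>1\<close>, as \<open>0\<close> lies in the closure of \<open>U\<close>; over a point of the hull it is nonempty. Mixing the two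
  with weights \<open>u\<close> and \<open>1 - u\<close> gives a fibre of length at least \<open>u\<close>.\<close>

lemma skew_body_fibre_length:
  fixes U :: "'a::euclidean_space set"
  assumes U: "open U" "convex U" "0 \<in> closure U"
    and u: "0 < u" "u < 1" and x: "x \<in> (*\<^sub>R) (1 - u) ` (convex hull (U \<union> uminus ` U))"
  shows "ennreal u \<le> emeasure lborel ((\<lambda>t. (t, x)) -` skew_body U)"
proof -
  from x obtain y where y: "y \<in> convex hull (U \<union> uminus ` U)" and xy: "x = (1 - u) *\<^sub>R y"
    by (rule imageE)
  have "y \<in> (\<Union>\<theta>\<in>{0<..<1}. skew_difference U \<theta>)"
    using convex_hull_Un_uminus_subset_skew_difference[OF U(1,2)] y by (rule subsetD)
  then obtain \<theta> a b where \<theta>: "0 < \<theta>" "\<theta> < 1" and ab: "a \<in> U" "b \<in> U"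
    and y': "y = (1 - \<theta>) *\<^sub>R a - \<theta> *\<^sub>R b"
    by (auto simp: skew_difference_def)
  note x = xy[unfolded y']
  let ?l = "(1 - u) * \<theta> - 1 / 2"
  have "{?l <..< ?l + u} \<subseteq> (\<lambda>t. (t, x)) -` skew_body U"
  proof
    fix t assume "t \<in> {?l <..< ?l + u}"
    define \<tau> where "\<tau> = 1 / 2 + t"
    have \<tau>: "(1 - u) * \<theta> < \<tau>" "\<tau> < (1 - u) * \<theta> + u"
      using \<open>t \<in> _\<close> by (auto simp: \<tau>_def)
    have e: "(1 - u) * \<theta> + u = 1 - (1 - u) * (1 - \<theta>)" by (simp add: algebra_simps)
    have p: "0 < (1 - u) * \<theta>" "0 < (1 - u) * (1 - \<theta>)" using u \<theta> by auto
    have \<tau>': "0 < \<tau>" "\<tau> < 1" "(1 - u) * (1 - \<theta>) < 1 - \<tau>" using \<tau> p e by linarith+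
    let ?a = "((1 - u) * (1 - \<theta>) / (1 - \<tau>)) *\<^sub>R a" and ?b = "((1 - u) * \<theta> / \<tau>) *\<^sub>R b"
    have "?a \<in> U" "?b \<in> U"
      using p \<tau> \<tau>' ab by (auto intro!: scaleR_mem_of_zero_in_closure U)
    moreover have "x = (1 - \<tau>) *\<^sub>R ?a - \<tau> *\<^sub>R ?b"
      using \<tau>' by (simp add: x scaleR_diff_right)
    ultimately have "x \<in> skew_difference U \<tau>"
      unfolding skew_difference_def by (intro image_eqI[of _ _ "(?a, ?b)"]) auto
    then show "t \<in> (\<lambda>t. (t, x)) -` skew_body U"
      using \<tau>' by (auto simp: skew_body_def \<tau>_def abs_if)
  qed
  moreover have "open ((\<lambda>t. (t, x)) -` skew_body U)"
    using open_skew_body[OF U(1)] by (intro open_vimage continuous_intros)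
  ultimately have "emeasure lborel {?l <..< ?l + u} \<le> emeasure lborel ((\<lambda>t. (t, x)) -` skew_body U)"
    by (intro emeasure_mono) auto
  then show ?thesis using u by simp
qed

text \<open>The hull is the projection of the skew body. The estimate along homotheties is applied in \<open>\<real>\<^sup>n\<close> to
  the fibre length, with \<open>k = 1\<close>; the constant is the integral \<open>1 / (n + 1)\<close> of \<open>(1 - u)\<^sup>n\<close>.\<close>

lemma (in radial_measure) emeasure_hull_le:
  fixes U :: "'a set"
  assumes U: "open U" "convex U" "0 \<in> closure U"
  shows "emeasure M (convex hull (U \<union> uminus ` U))
    \<le> ennreal (real DIM('a) + 1) * emeasure (lborel \<Otimes>\<^sub>M M) (skew_body U)"
proof -
  interpret P: pair_sigma_finite "lborel :: real measure" M ..
  interpret R: radial_measure "lborel \<Otimes>\<^sub>M M :: (real \<times> 'a) measure" by (rule radial_measure_pair)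
  let ?L = "convex hull (U \<union> uminus ` U)" and ?n = "real DIM('a) + 1"
  have "open ?L" using U by (intro open_convex_hull open_Un open_negations) auto
  then have "ennreal (1 * (real 1 * beta_integral (1 - 1) DIM('a))) * emeasure M ?L
      \<le> (\<integral>\<^sup>+x. emeasure lborel ((\<lambda>t. (t, x)) -` skew_body U) \<partial>M)"
    using skew_body_fibre_length[OF U]
    by (intro nn_integral_ge_of_homothetic_lower_bound) auto
  also have "\<dots> = emeasure (lborel \<Otimes>\<^sub>M M) (skew_body U)"
    using open_skew_body[OF U(1)]
    by (intro P.emeasure_pair_measure_alt2[symmetric]) (unfold R.sets_eq_borel, simp)
  finally have "ennreal (1 / ?n) * emeasure M ?L \<le> emeasure (lborel \<Otimes>\<^sub>M M) (skew_body U)"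
    by (simp add: beta_integral_0 add.commute)
  then have "ennreal ?n * (ennreal (1 / ?n) * emeasure M ?L)
      \<le> ennreal ?n * emeasure (lborel \<Otimes>\<^sub>M M) (skew_body U)"
    by (rule mult_left_mono) simp
  moreover have "ennreal ?n * ennreal (1 / ?n) = ennreal (?n * (1 / ?n))"
    by (rule ennreal_mult[symmetric]) simp_all
  then have "ennreal ?n * (ennreal (1 / ?n) * emeasure M ?L) = emeasure M ?L"
    unfolding mult.assoc[symmetric] by (simp add: add_nonneg_eq_0_iff del: ennreal_plus)
  ultimately show ?thesis by simp
qed

section \<open>Integrating over levels\<close>

lemma le_SUP_rational_levels:
  fixes C :: "real \<Rightarrow> 'b set"
  assumes "\<And>s. s \<in> \<rat> \<Longrightarrow> 0 < s \<Longrightarrow> s \<le> m \<Longrightarrow> x \<in> C s"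
  shows "ennreal m \<le> (SUP s\<in>{s\<in>\<rat>. 0 < s}. ennreal s * indicator (C s) x)" (is "_ \<le> ?S")
proof (rule ccontr)
  assume "\<not> ?thesis"
  then have less: "?S < ennreal m" by simp
  then obtain r where r: "?S = ennreal r" "0 \<le> r"
    by (cases ?S) auto
  then have "r < m" using less by (auto simp: ennreal_less_iff)
  then obtain q where q: "q \<in> \<rat>" "r < q" "q < m" using Rats_dense_in_real by blast
  then have "ennreal q * indicator (C q) x \<le> ?S" using r by (intro SUP_upper) auto
  moreover have "x \<in> C q" using assms[of q] q r by auto
  ultimately show False using q r by (simp add: r)
qed

text \<open>A layer-cake bound. Restricting the supremum to rational levels keeps the set under the graph a
  countable union of measurable rectangles, so that it is measurable and Fubini's theorem applies.\<close>

lemma nn_integral_SUP_levels_le: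
  fixes C :: "real \<Rightarrow> 'b set"
  assumes "sigma_finite_measure P"
    and C: "\<And>s. 0 < s \<Longrightarrow> C s \<in> sets P"
    and anti: "\<And>s t. 0 < s \<Longrightarrow> s \<le> t \<Longrightarrow> C t \<subseteq> C s"
  shows "(\<integral>\<^sup>+x. (SUP s\<in>{s\<in>\<rat>. 0 < s}. ennreal s * indicator (C s) x) \<partial>P)
    \<le> (\<integral>\<^sup>+t. emeasure P (C t) * indicator {0<..} t \<partial>lborel)"
proof -
  interpret P: sigma_finite_measure P by fact
  interpret PL: pair_sigma_finite P "lborel :: real measure" ..
  define W where "W = (\<Union>s\<in>{s\<in>\<rat>. 0 < s}. C s \<times> {0<..<s})"
  have W: "W \<in> sets (P \<Otimes>\<^sub>M lborel)"
    unfolding W_def using C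
    by (intro sets.countable_UN' countable_subset[OF _ countable_rat]) (auto intro!: pair_measureI)
  have "(\<integral>\<^sup>+x. (SUP s\<in>{s\<in>\<rat>. 0 < s}. ennreal s * indicator (C s) x) \<partial>P)
      \<le> (\<integral>\<^sup>+x. emeasure lborel (Pair x -` W) \<partial>P)"
  proof (intro nn_integral_mono SUP_least)
    fix x :: 'b and s :: real assume s: "s \<in> {s\<in>\<rat>. 0 < s}"
    show "ennreal s * indicator (C s) x \<le> emeasure lborel (Pair x -` W)"
    proof (cases "x \<in> C s")
      case True
      then have "emeasure lborel {0<..<s} \<le> emeasure lborel (Pair x -` W)"
        using s sets_Pair1[OF W] by (intro emeasure_mono) (auto simp: W_def)
      then show ?thesis using s True by simp
    qed simp
  qed
  also have "\<dots> = emeasure (P \<Otimes>\<^sub>M lborel) W"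
    using W by (rule lborel.emeasure_pair_measure_alt[symmetric])
  also have "\<dots> = (\<integral>\<^sup>+t. emeasure P ((\<lambda>x. (x, t)) -` W) \<partial>lborel)"
    using W by (rule PL.emeasure_pair_measure_alt2)
  also have "\<dots> \<le> (\<integral>\<^sup>+t. emeasure P (C t) * indicator {0<..} t \<partial>lborel)"
  proof (intro nn_integral_mono)
    fix t :: real
    show "emeasure P ((\<lambda>x. (x, t)) -` W) \<le> emeasure P (C t) * indicator {0<..} t"
    proof (cases "0 < t")
      case True
      have "(\<lambda>x. (x, t)) -` W \<subseteq> C t"
      proof
        fix x assume "x \<in> (\<lambda>x. (x, t)) -` W"
        then obtain s where "x \<in> C s" "t < s" by (auto simp: W_def)
        then show "x \<in> C t" using anti[of t s] True by auto
      qed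
      then show ?thesis using True C by (auto intro: emeasure_mono)
    next
      case False
      then have "(\<lambda>x. (x, t)) -` W = {}" by (auto simp: W_def)
      then show ?thesis by simp
    qed
  qed
  finally show ?thesis .
qed

section \<open>Passing from convex sets to their interiors\<close>

lemma sets_lebesgue_convex:
  fixes S :: "'a::euclidean_space set"
  assumes "convex S"
  shows "S \<in> sets lebesgue"
proof -
  have "negligible (S - interior S)"
    using negligible_convex_frontier[OF assms] closure_subset[of S]
    by (auto simp: frontier_def intro: negligible_subset)
  moreover have "interior S \<in> sets lebesgue" by simp
  ultimately have "interior S \<union> (S - interior S) \<in> sets lebesgue"
    by (metis sets.Un negligible_imp_sets)
  then show ?thesis using interior_subset[of S] by (simp add: Un_absorb1)
qed

text \<open>The frontier of a convex set is negligible, and the closure of an open set exceeds it only by the frontier.\<close>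

lemma negligible_diff_dense_open_convex:
  fixes D :: "'a::euclidean_space set"
  assumes "open D" "convex D" "S \<subseteq> closure D"
  shows "negligible (S - D)"
  using negligible_convex_frontier[OF assms(2)] assms
  by (auto simp: frontier_def interior_open intro: negligible_subset)

lemma open_skew_difference:
  fixes U :: "'a::euclidean_space set"
  assumes "open U" "0 < \<theta>" "\<theta> < 1"
  shows "open (skew_difference U \<theta>)"
proof -
  have "skew_difference U \<theta> = Pair (\<theta> - 1 / 2) -` skew_body U"
    using assms by (auto simp: skew_body_def abs_if)
  then show ?thesis
    using open_skew_body[OF assms(1)] by (auto intro!: open_vimage continuous_intros)
qed

text \<open>If \<open>K\<close> has interior points, it lies in the closure of its interior and the difference is contained in
  the frontier of a convex set. Otherwise \<open>K\<close> lies in a hyperplane, and its skew difference in a parallel one.\<close>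

lemma negligible_skew_difference_interior:
  fixes K :: "'a::euclidean_space set"
  assumes K: "convex K" and \<theta>: "0 < \<theta>" "\<theta> < 1"
  shows "negligible (skew_difference K \<theta> - skew_difference (interior K) \<theta>)"
proof (cases "interior K = {}")
  case True
  then obtain a b where ab: "a \<noteq> 0" "K \<subseteq> {x. a \<bullet> x = b}"
    using empty_interior_subset_hyperplane[OF K] by metis
  have "skew_difference K \<theta> \<subseteq> {x. a \<bullet> x = (1 - \<theta>) * b - \<theta> * b}"
  proof
    fix x assume "x \<in> skew_difference K \<theta>"
    then obtain p q where "p \<in> K" "q \<in> K" "x = (1 - \<theta>) *\<^sub>R p - \<theta> *\<^sub>R q"
      by (auto simp: skew_difference_def)
    moreover from this have "a \<bullet> p = b" "a \<bullet> q = b" using ab(2) by auto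
    ultimately show "x \<in> {x. a \<bullet> x = (1 - \<theta>) * b - \<theta> * b}"
      by (simp add: inner_diff_right)
  qed
  then show ?thesis
    using negligible_hyperplane[of a] ab(1) by (auto intro: negligible_subset)
next
  case False
  have "skew_difference K \<theta> \<subseteq> closure (skew_difference (interior K) \<theta>)"
  proof -
    have "K \<subseteq> closure (interior K)"
      using convex_closure_interior[OF K False] closure_subset by blast
    then have "skew_difference K \<theta> \<subseteq> (\<lambda>(a, b). (1 - \<theta>) *\<^sub>R a - \<theta> *\<^sub>R b) ` closure (interior K \<times> interior K)"
      unfolding skew_difference_def closure_Times by (intro image_mono Sigma_mono)
    also have "\<dots> \<subseteq> closure (skew_difference (interior K) \<theta>)"
      unfolding skew_difference_def
      by (intro image_closure_subset closure_subset closed_closure)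
         (auto simp: case_prod_unfold intro!: continuous_intros)
    finally show ?thesis .
  qed
  then show ?thesis
    using K \<theta> by (intro negligible_diff_dense_open_convex open_skew_difference convex_skew_difference) auto
qed

text \<open>As for the skew difference; here \<open>0 \<in> K\<close> forces a hyperplane containing \<open>K\<close> to pass through the origin,
  so that it contains \<open>-K\<close> too.\<close>

lemma negligible_hull_interior:
  fixes K :: "'a::euclidean_space set"
  assumes K: "convex K" "0 \<in> K"
  shows "negligible (convex hull (K \<union> uminus ` K) - convex hull (interior K \<union> uminus ` interior K))"
proof (cases "interior K = {}")
  case True
  then obtain a b where ab: "a \<noteq> 0" "K \<subseteq> {x. a \<bullet> x = b}"
    using empty_interior_subset_hyperplane[OF K(1)] by metis
  then have "b = 0" using K(2) by auto
  then have "convex hull (K \<union> uminus ` K) \<subseteq> {x. a \<bullet> x = 0}"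
    using ab(2) by (intro hull_minimal convex_hyperplane) auto
  then show ?thesis
    using negligible_hyperplane[of a] ab(1) by (auto intro: negligible_subset)
next
  case False
  let ?D = "convex hull (interior K \<union> uminus ` interior K)"
  have "K \<subseteq> closure (interior K)"
    using convex_closure_interior[OF K(1) False] closure_subset by blast
  moreover have "closure (interior K) \<subseteq> closure ?D"
    by (intro closure_mono) (auto intro: hull_inc)
  moreover have "uminus ` closure (interior K) \<subseteq> closure ?D"
  proof -
    have "uminus ` closure (interior K) \<subseteq> closure (uminus ` interior K)"
      by (intro image_closure_subset closure_subset closed_closure continuous_intros)
    also have "\<dots> \<subseteq> closure ?D"
      by (intro closure_mono) (auto intro: hull_inc)
    finally show ?thesis .
  qed
  ultimately have "K \<union> uminus ` K \<subseteq> closure ?D" by blast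
  then have "convex hull (K \<union> uminus ` K) \<subseteq> closure ?D"
    by (intro hull_minimal convex_closure convex_convex_hull)
  then show ?thesis
    by (intro negligible_diff_dense_open_convex open_convex_hull open_Un open_negations convex_convex_hull) auto
qed

section \<open>Measures with radially decreasing density\<close>

lemma nn_integral_lebesgue_scaleR:
  fixes g :: "'a::euclidean_space \<Rightarrow> ennreal"
  assumes g: "g \<in> borel_measurable lebesgue" and r: "0 < r"
  shows "(\<integral>\<^sup>+x. g x \<partial>lebesgue) = ennreal (r ^ DIM('a)) * (\<integral>\<^sup>+x. g (r *\<^sub>R x) \<partial>lebesgue)"
proof -
  have T: "(\<lambda>x::'a. 0 + (\<Sum>j\<in>Basis. (r * (x \<bullet> j)) *\<^sub>R j)) = (*\<^sub>R) r"
    unfolding scaleR_scaleR[symmetric] scaleR_sum_right[symmetric] euclidean_representation by auto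
  have m: "(*\<^sub>R) r \<in> lebesgue \<rightarrow>\<^sub>M (lebesgue :: 'a measure)"
    using lebesgue_affine_measurable[of "\<lambda>_::'a. r" 0] r unfolding T by simp
  have "lebesgue = density (distr lebesgue lebesgue ((*\<^sub>R) r)) (\<lambda>_::'a. \<Prod>j\<in>(Basis::'a set). \<bar>r\<bar>)"
    using lebesgue_affine_euclidean[of "\<lambda>_::'a. r" 0] r unfolding T by simp
  then have eq: "lebesgue = density (distr lebesgue lebesgue ((*\<^sub>R) r)) (\<lambda>_::'a. ennreal (r ^ DIM('a)))"
    using r by simp
  have "(\<integral>\<^sup>+x. g x \<partial>lebesgue)
      = (\<integral>\<^sup>+x. g x \<partial>density (distr lebesgue lebesgue ((*\<^sub>R) r)) (\<lambda>_::'a. ennreal (r ^ DIM('a))))"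
    using eq by simp
  also have "\<dots> = (\<integral>\<^sup>+x. ennreal (r ^ DIM('a)) * g x \<partial>distr lebesgue lebesgue ((*\<^sub>R) r))"
    using g by (intro nn_integral_density) auto
  also have "\<dots> = (\<integral>\<^sup>+x. ennreal (r ^ DIM('a)) * g (r *\<^sub>R x) \<partial>lebesgue)"
    using g m by (intro nn_integral_distr) auto
  also have "\<dots> = ennreal (r ^ DIM('a)) * (\<integral>\<^sup>+x. g (r *\<^sub>R x) \<partial>lebesgue)"
    using measurable_compose[OF m g] by (intro nn_integral_cmult) auto
  finally show ?thesis .
qed

lemma emeasure_weighted_measure_scaleR_ge:
  fixes \<phi> :: "real ^ 'n \<Rightarrow> real"
  assumes \<phi>: "\<phi> \<in> borel_measurable lebesgue" "radially_decreasing \<phi>"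
    and A: "open A" and r: "0 < r" "r \<le> 1"
  shows "ennreal (r ^ DIM(real ^ 'n)) * emeasure (weighted_measure \<phi>) A
    \<le> emeasure (weighted_measure \<phi>) ((*\<^sub>R) r ` A)"
proof -
  have rA: "open ((*\<^sub>R) r ` A)" using A r by (intro open_scaling) auto
  have mem: "r *\<^sub>R x \<in> (*\<^sub>R) r ` A \<longleftrightarrow> x \<in> A" for x using r by auto
  have [measurable]: "A \<in> sets lebesgue" "(*\<^sub>R) r ` A \<in> sets lebesgue" using A rA by auto
  note \<phi>(1)[measurable]
  have "ennreal (r ^ DIM(real ^ 'n)) * emeasure (weighted_measure \<phi>) A
      = ennreal (r ^ DIM(real ^ 'n)) * (\<integral>\<^sup>+x. ennreal (\<phi> x) * indicator A x \<partial>lebesgue)"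
    unfolding weighted_measure_def by (subst emeasure_density) auto
  also have "\<dots> \<le> ennreal (r ^ DIM(real ^ 'n))
      * (\<integral>\<^sup>+x. ennreal (\<phi> (r *\<^sub>R x)) * indicator ((*\<^sub>R) r ` A) (r *\<^sub>R x) \<partial>lebesgue)"
    using \<phi>(2) r unfolding radially_decreasing_def
    by (intro mult_left_mono nn_integral_mono) (auto simp: mem indicator_def intro: ennreal_leI)
  also have "\<dots> = (\<integral>\<^sup>+x. ennreal (\<phi> x) * indicator ((*\<^sub>R) r ` A) x \<partial>lebesgue)"
    by (rule nn_integral_lebesgue_scaleR[symmetric, OF _ r(1)]) simp
  also have "\<dots> = emeasure (weighted_measure \<phi>) ((*\<^sub>R) r ` A)"
    unfolding weighted_measure_def by (subst emeasure_density) auto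
  finally show ?thesis .
qed

text \<open>The density may fail to be Borel, and a Borel version of it need not be radially decreasing. The
  scaling property is therefore derived from the original density on the completed measure, and then
  transferred to the Borel sets, where the two measures agree.\<close>

lemma weighted_measure_Borel_representative:
  fixes \<phi> :: "real ^ 'n \<Rightarrow> real"
  assumes \<phi>: "\<phi> \<in> borel_measurable lebesgue" "radially_decreasing \<phi>"
  obtains M where "radial_measure M"
    "\<And>A. A \<in> sets borel \<Longrightarrow> emeasure M A = emeasure (weighted_measure \<phi>) A"
    "\<And>g. g \<in> borel_measurable borel \<Longrightarrow> (\<integral>\<^sup>+x. g x \<partial>weighted_measure \<phi>) = (\<integral>\<^sup>+x. g x \<partial>M)"
proof -
  obtain \<psi> where \<psi>: "\<psi> \<in> borel_measurable lborel" "AE x in lborel. \<phi> x = \<psi> x"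
    using completion_ex_borel_measurable_real[OF \<phi>(1)] by blast
  have \<psi>m [measurable]: "\<psi> \<in> borel_measurable borel" using \<psi>(1) by simp
  note \<phi>(1)[measurable]
  define M where "M = density lborel (\<lambda>x. ennreal (\<psi> x))"
  have int: "(\<integral>\<^sup>+x. g x \<partial>weighted_measure \<phi>) = (\<integral>\<^sup>+x. g x \<partial>M)"
    if [measurable]: "g \<in> borel_measurable borel" for g
  proof -
    have "g \<in> borel_measurable lebesgue"
      using that by (simp add: measurable_completion)
    then have "(\<integral>\<^sup>+x. g x \<partial>weighted_measure \<phi>) = (\<integral>\<^sup>+x. ennreal (\<phi> x) * g x \<partial>lebesgue)"
      unfolding weighted_measure_def by (intro nn_integral_density) auto
    also have "\<dots> = (\<integral>\<^sup>+x. ennreal (\<phi> x) * g x \<partial>lborel)"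
      by (rule nn_integral_completion)
    also have "\<dots> = (\<integral>\<^sup>+x. ennreal (\<psi> x) * g x \<partial>lborel)"
      using \<psi>(2) by (intro nn_integral_cong_AE) auto
    also have "\<dots> = (\<integral>\<^sup>+x. g x \<partial>M)"
      unfolding M_def by (intro nn_integral_density[symmetric]) auto
    finally show ?thesis .
  qed
  have em: "emeasure M A = emeasure (weighted_measure \<phi>) A" if "A \<in> sets borel" for A
    using int[of "indicator A"] that by (simp add: M_def weighted_measure_def)
  have "sigma_finite_measure M"
    unfolding M_def by (subst sigma_finite_measure.sigma_finite_iff_density_finite[OF sigma_finite_lborel]) auto
  moreover have "radial_measure_axioms M"
  proof
    show "sets M = sets borel" by (simp add: M_def)
    fix A :: "(real ^ 'n) set" and r :: real assume A: "open A" "0 < r" "r \<le> 1"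
    have "open ((*\<^sub>R) r ` A)" using A by (intro open_scaling) auto
    then show "ennreal (r ^ DIM(real ^ 'n)) * emeasure M A \<le> emeasure M ((*\<^sub>R) r ` A)"
      using emeasure_weighted_measure_scaleR_ge[OF \<phi> A] A by (simp add: em)
  qed
  ultimately have "radial_measure M" by (rule radial_measure.intro)
  then show ?thesis using em int by (rule that)
qed

section \<open>Superlevel sets of the difference functions\<close>

lemma convex_superlevel:
  assumes "quasi_concave f"
  shows "convex (superlevel t f)"
  unfolding convex_alt
proof (intro ballI allI impI)
  fix x y u assume xy: "x \<in> superlevel t f" "y \<in> superlevel t f" and u: "0 \<le> u \<and> u \<le> (1::real)"
  show "(1 - u) *\<^sub>R x + u *\<^sub>R y \<in> superlevel t f"
  proof (cases "u = 0 \<or> u = 1")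
    case False
    then have "min (f x) (f y) \<le> f ((1 - u) *\<^sub>R x + u *\<^sub>R y)"
      using assms u by (auto simp: quasi_concave_def)
    then show ?thesis using xy by (auto simp: superlevel_def)
  qed (use xy in auto)
qed

lemma superlevel_antimono: "s \<le> t \<Longrightarrow> superlevel t f \<subseteq> superlevel s f"
  by (auto simp: superlevel_def)

lemma sets_lebesgue_superlevel:
  assumes "f \<in> borel_measurable lebesgue"
  shows "superlevel t f \<in> sets lebesgue"
  using measurable_sets[OF assms, of "{t..}"] by (simp add: superlevel_def vimage_def)

lemma emeasure_superlevel_finite:
  assumes f: "integrable lebesgue f" and t: "0 < t"
  shows "emeasure lebesgue (superlevel t f) < \<infinity>"
proof -
  have m: "superlevel t f \<in> sets lebesgue"
    using f by (intro sets_lebesgue_superlevel) auto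
  have "ennreal t * emeasure lebesgue (superlevel t f) = (\<integral>\<^sup>+x. ennreal t * indicator (superlevel t f) x \<partial>lebesgue)"
    using m by (simp add: nn_integral_cmult_indicator)
  also have "\<dots> \<le> (\<integral>\<^sup>+x. ennreal (norm (f x)) \<partial>lebesgue)"
    by (intro nn_integral_mono) (auto simp: superlevel_def indicator_def intro!: ennreal_leI)
  also have "\<dots> < \<infinity>" using f by (simp add: integrable_iff_bounded)
  finally show ?thesis
    using t by (auto simp: ennreal_mult_less_top)
qed

lemma AE_lebesgue_mem_of_negligible_diff:
  assumes "negligible (S - T)"
  shows "AE x in lebesgue. x \<in> S \<longrightarrow> x \<in> T"
  using AE_not_in[of "S - T" lebesgue] assms by (simp add: negligible_iff_null_sets)

text \<open>A pair \<open>(x, y)\<close> in the supremum contributes to every level \<open>s\<close> up to \<open>min (f x) (f y)\<close>. Replacing the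
  superlevel sets by their interiors, which makes the right-hand side Borel in \<open>\<theta>\<close> and \<open>z\<close> jointly,
  costs a null set for each rational level.\<close>

lemma Delta_le_levels_AE:
  fixes f :: "real ^ 'n \<Rightarrow> real"
  assumes f: "quasi_concave f" and \<theta>: "0 < \<theta>" "\<theta> < 1"
  shows "AE z in lebesgue. Delta \<theta> f z \<le>
    (SUP s\<in>{s\<in>\<rat>. 0 < s}. ennreal s * indicator (skew_body (interior (superlevel s f))) (\<theta> - 1 / 2, z))"
proof -
  have "AE z in lebesgue. \<forall>s\<in>\<rat>. z \<in> skew_difference (superlevel s f) \<theta> \<longrightarrow>
      z \<in> skew_difference (interior (superlevel s f)) \<theta>"
    using negligible_skew_difference_interior[OF convex_superlevel[OF f] \<theta>]
    by (subst AE_ball_countable[OF countable_rat]) (auto intro!: AE_lebesgue_mem_of_negligible_diff)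
  then show ?thesis
  proof eventually_elim
    case (elim z)
    show ?case
      unfolding Delta_def
    proof (intro SUP_least, clarify)
      fix x y assume z: "z = (1 - \<theta>) *\<^sub>R x - \<theta> *\<^sub>R y"
      show "ennreal (min (f x) (f y)) \<le> (SUP s\<in>{s\<in>\<rat>. 0 < s}. ennreal s *
          indicator (skew_body (interior (superlevel s f))) (\<theta> - 1 / 2, (1 - \<theta>) *\<^sub>R x - \<theta> *\<^sub>R y))"
        unfolding z[symmetric]
      proof (rule le_SUP_rational_levels)
        fix s assume s: "s \<in> \<rat>" "0 < s" "s \<le> min (f x) (f y)"
        then have "z \<in> skew_difference (superlevel s f) \<theta>"
          unfolding skew_difference_def z
          by (intro image_eqI[of _ _ "(x, y)"]) (auto simp: superlevel_def)
        then have "z \<in> skew_difference (interior (superlevel s f)) \<theta>" using elim s by blast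
        then show "(\<theta> - 1 / 2, z) \<in> skew_body (interior (superlevel s f))"
          using \<theta> by (simp add: skew_body_def abs_if)
      qed
    qed
  qed
qed

text \<open>The same with the hulls, which contain all the skew differences. The maximum at the origin makes the origin
  a point of every nonempty superlevel set.\<close>

lemma Delta_tilde_le_levels_AE:
  fixes f :: "real ^ 'n \<Rightarrow> real"
  assumes f: "quasi_concave f" and max: "\<And>x. f x \<le> f 0"
  shows "AE z in lebesgue. Delta_tilde f z \<le>
    (SUP s\<in>{s\<in>\<rat>. 0 < s}. ennreal s *
      indicator (convex hull (interior (superlevel s f) \<union> uminus ` interior (superlevel s f))) z)"
proof -
  let ?L = "\<lambda>K :: (real ^ 'n) set. convex hull (K \<union> uminus ` K)"
  have "AE z in lebesgue. z \<in> ?L (superlevel s f) \<longrightarrow> z \<in> ?L (interior (superlevel s f))" for s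
  proof (cases "superlevel s f = {}")
    case False
    then have "0 \<in> superlevel s f" using max by (auto simp: superlevel_def intro: order_trans)
    then show ?thesis
      by (intro AE_lebesgue_mem_of_negligible_diff negligible_hull_interior convex_superlevel f)
  qed simp
  then have "AE z in lebesgue. \<forall>s\<in>\<rat>. z \<in> ?L (superlevel s f) \<longrightarrow> z \<in> ?L (interior (superlevel s f))"
    by (subst AE_ball_countable[OF countable_rat]) auto
  then show ?thesis
  proof eventually_elim
    case (elim z)
    show ?case
      unfolding Delta_tilde_def
    proof (intro SUP_least, clarify)
      fix \<theta> x y assume \<theta>: "\<theta> \<in> {0..1::real}" and z: "z = (1 - \<theta>) *\<^sub>R x - \<theta> *\<^sub>R y"
      show "ennreal (min (f x) (f y)) \<le> (SUP s\<in>{s\<in>\<rat>. 0 < s}. ennreal s *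
          indicator (?L (interior (superlevel s f))) ((1 - \<theta>) *\<^sub>R x - \<theta> *\<^sub>R y))"
        unfolding z[symmetric]
      proof (rule le_SUP_rational_levels)
        fix s assume s: "s \<in> \<rat>" "0 < s" "s \<le> min (f x) (f y)"
        let ?K = "superlevel s f"
        have "x \<in> ?L ?K" "- y \<in> ?L ?K"
          using s by (auto simp: superlevel_def intro!: hull_inc)
        then have "(1 - \<theta>) *\<^sub>R x + \<theta> *\<^sub>R (- y) \<in> ?L ?K"
          using \<theta> by (intro convexD[OF convex_convex_hull]) auto
        then show "z \<in> ?L (interior ?K)" using elim s z by auto
      qed
    qed
  qed
qed

lemma ennreal_le_mult_of_divide_le:
  fixes a b :: ennreal
  assumes "a / ennreal c \<le> b" "0 < c"
  shows "a \<le> ennreal c * b"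
proof -
  have "a = a * ennreal c / ennreal c" using assms mult_divide_eq_ennreal[of "ennreal c" a] by simp
  also have "\<dots> = a / ennreal c * ennreal c" by (simp add: ennreal_divide_times ennreal_times_divide)
  also have "\<dots> \<le> b * ennreal c" by (intro mult_right_mono assms) simp
  finally show ?thesis by (simp add: mult.commute)
qed

section \<open>The integral inequalities\<close>

text \<open>The supremum that is integrated over the levels on the right-hand side of the two weighted
  inequalities, for a single superlevel set \<open>K\<close>.\<close>

definition max_translate_ratio :: "(real ^ 'n \<Rightarrow> real) \<Rightarrow> (real ^ 'n) set \<Rightarrow> ennreal" where
  "max_translate_ratio \<phi> K = (SUP (y, \<theta>) \<in> K \<times> {0<..1}.
     emeasure (weighted_measure \<phi>) ((\<lambda>s. (1 - \<theta>) *\<^sub>R y - \<theta> *\<^sub>R s) ` K) / ennreal (\<theta> ^ CARD('n)))"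

lemma sets_weighted_measure_affine_image:
  assumes "convex K"
  shows "(\<lambda>s. (1 - \<theta>) *\<^sub>R y - \<theta> *\<^sub>R s) ` K \<in> sets (weighted_measure \<phi>)"
proof -
  have "(\<lambda>s. (1 - \<theta>) *\<^sub>R y - \<theta> *\<^sub>R s) ` K = (\<lambda>s. (1 - \<theta>) *\<^sub>R y + (- \<theta>) *\<^sub>R s) ` K" by simp
  also have "convex \<dots>" using assms by (rule convex_affinity)
  finally show ?thesis by (simp add: weighted_measure_def sets_lebesgue_convex)
qed

lemma emeasure_le_max_translate_ratio:
  fixes K :: "(real ^ 'n) set"
  assumes "convex K" "y \<in> K" "0 < \<theta>" "\<theta> \<le> 1" "U \<subseteq> K"
  shows "emeasure (weighted_measure \<phi>) ((\<lambda>s. (1 - \<theta>) *\<^sub>R y - \<theta> *\<^sub>R s) ` U)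
    \<le> ennreal (\<theta> ^ CARD('n)) * max_translate_ratio \<phi> K"
proof -
  have "emeasure (weighted_measure \<phi>) ((\<lambda>s. (1 - \<theta>) *\<^sub>R y - \<theta> *\<^sub>R s) ` U)
      \<le> emeasure (weighted_measure \<phi>) ((\<lambda>s. (1 - \<theta>) *\<^sub>R y - \<theta> *\<^sub>R s) ` K)"
    using assms by (intro emeasure_mono image_mono sets_weighted_measure_affine_image)
  also have "\<dots> \<le> ennreal (\<theta> ^ CARD('n)) * max_translate_ratio \<phi> K"
    unfolding max_translate_ratio_def using assms
    by (intro ennreal_le_mult_of_divide_le SUP_upper2[of "(y, \<theta>)"]) auto
  finally show ?thesis .
qed

lemma max_translate_ratio_mono:
  assumes "convex L" "K \<subseteq> L"
  shows "max_translate_ratio \<phi> K \<le> max_translate_ratio \<phi> L"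
  unfolding max_translate_ratio_def
proof (intro SUP_mono, clarify)
  fix y \<theta> assume y: "y \<in> K" "\<theta> \<in> {0<..1::real}"
  show "\<exists>p\<in>L \<times> {0<..1}. emeasure (weighted_measure \<phi>) ((\<lambda>s. (1 - \<theta>) *\<^sub>R y - \<theta> *\<^sub>R s) ` K) / ennreal (\<theta> ^ CARD('a))
      \<le> (case p of (y, \<theta>) \<Rightarrow> emeasure (weighted_measure \<phi>) ((\<lambda>s. (1 - \<theta>) *\<^sub>R y - \<theta> *\<^sub>R s) ` L) / ennreal (\<theta> ^ CARD('a)))"
    using assms y
    by (intro bexI[of _ "(y, \<theta>)"])
       (auto intro!: divide_right_mono_ennreal emeasure_mono image_mono sets_weighted_measure_affine_image)
qed

text \<open>The sets \<open>{t. y < h t}\<close> are intervals. This gives measurability of the supremum, an uncountable one,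
  as a function of the level.\<close>

lemma borel_measurable_lebesgue_antimono:
  fixes h :: "real \<Rightarrow> ennreal"
  assumes "antimono h"
  shows "h \<in> borel_measurable lebesgue"
proof (rule borel_measurableI_greater)
  fix y
  have "convex {t. y < h t}"
    unfolding is_interval_convex_1[symmetric] is_interval_1
    using assms by (auto dest: antimonoD intro: less_le_trans)
  then show "{t \<in> space lebesgue. y < h t} \<in> sets lebesgue"
    using sets_lebesgue_convex by simp
qed

text \<open>Both left-hand sides are integrals of the layers \<open>skew_body (?U t)\<close> and \<open>?L t\<close>, built on the interiors
  of the superlevel sets, and the set bounds apply to each layer \<open>t > 0\<close>, where integrability gives
  the superlevel set finite volume.\<close>

lemma weighted_Delta_integral_bounds:
  fixes f \<phi> :: "real ^ 'n \<Rightarrow> real"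
  assumes f: "integrable lebesgue f" "quasi_concave f"
    and \<phi>: "\<phi> \<in> borel_measurable lebesgue" "radially_decreasing \<phi>"
  shows "(\<integral>\<^sup>+\<theta>\<in>{0..1}. (\<integral>\<^sup>+x. Delta \<theta> f x \<partial>weighted_measure \<phi>) \<partial>lebesgue)
      \<le> ennreal (2 ^ CARD('n) / (real CARD('n) + 1)) *
        (\<integral>\<^sup>+t\<in>{0..}. max_translate_ratio \<phi> (superlevel t f) \<partial>lebesgue)" (is ?one)
    and "(\<forall>x. f x \<le> f 0) \<Longrightarrow> (\<integral>\<^sup>+x. Delta_tilde f x \<partial>weighted_measure \<phi>)
      \<le> 2 ^ CARD('n) * (\<integral>\<^sup>+t\<in>{0..}. max_translate_ratio \<phi> (superlevel t f) \<partial>lebesgue)" (is "_ \<Longrightarrow> ?two")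
proof -
  let ?G = "\<lambda>t. max_translate_ratio \<phi> (superlevel t f)"
  let ?c = "2 ^ CARD('n) / (real CARD('n) + 1)"
  let ?U = "\<lambda>t. interior (superlevel t f)"
  obtain M where M: "radial_measure M"
    "\<And>A. A \<in> sets borel \<Longrightarrow> emeasure M A = emeasure (weighted_measure \<phi>) A"
    "\<And>g. g \<in> borel_measurable borel \<Longrightarrow> (\<integral>\<^sup>+x. g x \<partial>weighted_measure \<phi>) = (\<integral>\<^sup>+x. g x \<partial>M)"
    using weighted_measure_Borel_representative[OF \<phi>] by blast
  interpret M: radial_measure M by fact
  let ?P = "lborel \<Otimes>\<^sub>M M :: (real \<times> (real ^ 'n)) measure"
  interpret P: radial_measure ?P by (rule M.radial_measure_pair)
  note \<phi>(1)[measurable]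
  have cv: "convex (superlevel t f)" for t using f(2) by (rule convex_superlevel)
  have U: "open (?U t)" "convex (?U t)" for t using cv by auto
  have U_anti: "?U t \<subseteq> ?U s" if "s \<le> t" for s t
    using that by (intro interior_mono superlevel_antimono)
  have AE_weighted: "AE x in weighted_measure \<phi>. Q x" if "AE x in lebesgue. Q x" for Q
    using that unfolding weighted_measure_def by (subst AE_density) auto
  have body: "emeasure ?P (skew_body (?U t)) \<le> ennreal ?c * ?G t" if t: "0 < t" for t
  proof -
    have "emeasure lborel (?U t) = emeasure lebesgue (?U t)" by simp
    also have "\<dots> \<le> emeasure lebesgue (superlevel t f)"
      using sets_lebesgue_convex[OF cv] by (intro emeasure_mono interior_subset)
    also have "\<dots> < \<infinity>" using f(1) t by (rule emeasure_superlevel_finite)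
    finally have fin: "emeasure lborel (?U t) < \<infinity>" .
    have "emeasure M ((\<lambda>s. (1 - \<theta>) *\<^sub>R y - \<theta> *\<^sub>R s) ` ?U t) \<le> ennreal (\<theta> ^ DIM(real ^ 'n)) * ?G t"
      if y: "y \<in> ?U t" and \<theta>: "0 < \<theta>" "\<theta> < 1" for y \<theta>
    proof -
      have "open ((\<lambda>s. (- \<theta>) *\<^sub>R s + (1 - \<theta>) *\<^sub>R y) ` ?U t)"
      proof -
        have "open ((+) ((1 - \<theta>) *\<^sub>R y) ` ((*\<^sub>R) (- \<theta>) ` ?U t))"
          using \<theta> by (intro open_translation open_scaling) auto
        then show ?thesis by (simp add: image_image)
      qed
      then have "emeasure M ((\<lambda>s. (1 - \<theta>) *\<^sub>R y - \<theta> *\<^sub>R s) ` ?U t)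
          = emeasure (weighted_measure \<phi>) ((\<lambda>s. (1 - \<theta>) *\<^sub>R y - \<theta> *\<^sub>R s) ` ?U t)"
        by (intro M(2)) simp
      also have "\<dots> \<le> ennreal (\<theta> ^ CARD('n)) * ?G t"
        using y \<theta> interior_subset[of "superlevel t f"] by (intro emeasure_le_max_translate_ratio cv) auto
      finally show ?thesis by simp
    qed
    then show ?thesis using M.emeasure_skew_body_le[OF U fin] by simp
  qed
  have "antimono ?G"
    by (intro antimonoI max_translate_ratio_mono cv superlevel_antimono)
  then have [measurable]: "?G \<in> borel_measurable lebesgue"
    by (rule borel_measurable_lebesgue_antimono)
  have pos_part: "(\<integral>\<^sup>+t. h t * indicator {0<..} t \<partial>lborel) \<le> ennreal c * (\<integral>\<^sup>+t\<in>{0..}. ?G t \<partial>lebesgue)"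
    if "\<And>t. 0 < t \<Longrightarrow> h t \<le> ennreal c * ?G t" for h c
  proof -
    have "(\<integral>\<^sup>+t. h t * indicator {0<..} t \<partial>lborel) \<le> (\<integral>\<^sup>+t. ennreal c * (?G t * indicator {0..} t) \<partial>lborel)"
      using that by (intro nn_integral_mono) (auto split: split_indicator)
    also have "\<dots> = (\<integral>\<^sup>+t. ennreal c * (?G t * indicator {0..} t) \<partial>lebesgue)"
      by (rule nn_integral_completion[symmetric])
    also have "\<dots> = ennreal c * (\<integral>\<^sup>+t\<in>{0..}. ?G t \<partial>lebesgue)"
      by (intro nn_integral_cmult borel_measurable_times_ennreal borel_measurable_indicator) auto
    finally show ?thesis .
  qed
  have bodies: "open (skew_body (?U s))" for s by (intro open_skew_body U)
  have bodies_P: "skew_body (?U s) \<in> sets ?P" for s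
    unfolding P.sets_eq_borel using bodies by (rule borel_open)
  show ?one
  proof -
    let ?E = "\<lambda>p. SUP s\<in>{s\<in>\<rat>. 0 < s}. ennreal s * indicator (skew_body (?U s)) p"
    have E [measurable]: "?E \<in> borel_measurable (borel :: (real \<times> (real ^ 'n)) measure)"
      using bodies by (intro borel_measurable_SUP countable_subset[OF _ countable_rat]) auto
    have E_P: "?E \<in> borel_measurable ?P" using E unfolding measurable_cong_sets[OF P.sets_eq_borel refl] .
    have E_slice: "(\<lambda>x. ?E (t, x)) \<in> borel_measurable borel" for t
      by (rule measurable_compose[OF _ E]) simp
    have inner: "(\<lambda>t. \<integral>\<^sup>+x. ?E (t, x) \<partial>M) \<in> borel_measurable borel"
      using M.borel_measurable_nn_integral_fst[OF E_P] by simp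
    have "(\<integral>\<^sup>+\<theta>\<in>{0..1}. (\<integral>\<^sup>+x. Delta \<theta> f x \<partial>weighted_measure \<phi>) \<partial>lebesgue)
        \<le> (\<integral>\<^sup>+\<theta>. (\<integral>\<^sup>+x. ?E (- (1 / 2) + 1 * \<theta>, x) \<partial>M) \<partial>lebesgue)"
    proof (rule nn_integral_mono_AE)
      have "AE \<theta> in lebesgue. \<theta> \<noteq> 0 \<and> \<theta> \<noteq> (1::real)"
        using AE_completion[OF AE_lborel_singleton[of 0]] AE_completion[OF AE_lborel_singleton[of 1]]
        by eventually_elim auto
      then show "AE \<theta> in lebesgue. (\<integral>\<^sup>+x. Delta \<theta> f x \<partial>weighted_measure \<phi>) * indicator {0..1} \<theta>
          \<le> (\<integral>\<^sup>+x. ?E (- (1 / 2) + 1 * \<theta>, x) \<partial>M)"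
      proof eventually_elim
        case (elim \<theta>)
        show ?case
        proof (cases "\<theta> \<in> {0..1}")
          case True
          then have \<theta>: "0 < \<theta>" "\<theta> < 1" using elim by auto
          have "(\<integral>\<^sup>+x. Delta \<theta> f x \<partial>weighted_measure \<phi>) \<le> (\<integral>\<^sup>+x. ?E (\<theta> - 1 / 2, x) \<partial>weighted_measure \<phi>)"
            by (intro nn_integral_mono_AE AE_weighted Delta_le_levels_AE f(2) \<theta>)
          also have "\<dots> = (\<integral>\<^sup>+x. ?E (\<theta> - 1 / 2, x) \<partial>M)"
            by (intro M(3) E_slice)
          finally show ?thesis using True by simp
        qed simp
      qed
    qed
    also have "\<dots> = (\<integral>\<^sup>+\<theta>. (\<integral>\<^sup>+x. ?E (- (1 / 2) + 1 * \<theta>, x) \<partial>M) \<partial>lborel)"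
      by (rule nn_integral_completion)
    also have "\<dots> = (\<integral>\<^sup>+t. (\<integral>\<^sup>+x. ?E (t, x) \<partial>M) \<partial>lborel)"
      using nn_integral_real_affine[OF inner, of 1 "- (1 / 2)"] by simp
    also have "\<dots> = (\<integral>\<^sup>+p. ?E p \<partial>?P)"
      using E_P by (rule M.nn_integral_fst)
    also have "\<dots> \<le> (\<integral>\<^sup>+t. emeasure ?P (skew_body (?U t)) * indicator {0<..} t \<partial>lborel)"
      by (intro nn_integral_SUP_levels_le[OF P.sigma_finite_measure_axioms] skew_body_mono U_anti bodies_P)
    also have "\<dots> \<le> ennreal ?c * (\<integral>\<^sup>+t\<in>{0..}. ?G t \<partial>lebesgue)"
      by (intro pos_part body)
    finally show ?thesis .
  qed
  assume max: "\<forall>x. f x \<le> f 0"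
  let ?L = "\<lambda>t. convex hull (?U t \<union> uminus ` ?U t)"
  have L: "open (?L t)" for t
    using U by (intro open_convex_hull open_Un open_negations)
  show ?two
  proof -
    let ?E = "\<lambda>x. SUP s\<in>{s\<in>\<rat>. 0 < s}. ennreal s * indicator (?L s) x"
    have E [measurable]: "?E \<in> borel_measurable (borel :: (real ^ 'n) measure)"
      using L by (intro borel_measurable_SUP countable_subset[OF _ countable_rat]) auto
    have "(\<integral>\<^sup>+x. Delta_tilde f x \<partial>weighted_measure \<phi>) \<le> (\<integral>\<^sup>+x. ?E x \<partial>weighted_measure \<phi>)"
      using max by (intro nn_integral_mono_AE AE_weighted Delta_tilde_le_levels_AE f(2)) auto
    also have "\<dots> = (\<integral>\<^sup>+x. ?E x \<partial>M)" using E by (rule M(3))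
    also have "\<dots> \<le> (\<integral>\<^sup>+t. emeasure M (?L t) * indicator {0<..} t \<partial>lborel)"
      using L U_anti
      by (intro nn_integral_SUP_levels_le[OF M.sigma_finite_measure_axioms] hull_mono Un_mono image_mono)
         (auto simp: M.sets_eq_borel)
    also have "\<dots> \<le> ennreal (2 ^ CARD('n)) * (\<integral>\<^sup>+t\<in>{0..}. ?G t \<partial>lebesgue)"
    proof (rule pos_part)
      fix t :: real assume t: "0 < t"
      show "emeasure M (?L t) \<le> ennreal (2 ^ CARD('n)) * ?G t"
      proof (cases "?U t = {}")
        case False
        then obtain x where "x \<in> superlevel t f" using interior_subset by blast
        then have "0 \<in> superlevel t f" using max by (auto simp: superlevel_def intro: order_trans)
        then have 0: "0 \<in> closure (?U t)"
          using convex_closure_interior[OF cv False] closure_subset by blast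
        have "emeasure M (?L t) \<le> ennreal (real DIM(real ^ 'n) + 1) * emeasure ?P (skew_body (?U t))"
          by (rule M.emeasure_hull_le[OF U 0])
        also have "\<dots> \<le> ennreal (real DIM(real ^ 'n) + 1) * (ennreal ?c * ?G t)"
          by (intro mult_left_mono body t) simp
        also have "\<dots> = ennreal ((real CARD('n) + 1) * ?c) * ?G t"
          by (subst ennreal_mult) (auto simp: mult.assoc)
        also have "(real CARD('n) + 1) * ?c = 2 ^ CARD('n)"
          by (simp add: add_nonneg_eq_0_iff)
        finally show ?thesis .
      qed simp
    qed
    also have "ennreal (2 ^ CARD('n)) = 2 ^ CARD('n)"
      by (simp flip: ennreal_power)
    finally show ?thesis .
  qed
qed

lemma weighted_measure_one: "weighted_measure (\<lambda>_. 1) = (lebesgue :: (real ^ 'n) measure)"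
  by (simp add: weighted_measure_def density_1)

text \<open>For Lebesgue measure the ratio does not depend on \<open>y\<close> and \<open>\<theta>\<close>: the affine image has volume \<open>\<theta>\<^sup>n\<close> times
  that of \<open>K\<close>.\<close>

lemma max_translate_ratio_one_le:
  fixes K :: "(real ^ 'n) set"
  shows "max_translate_ratio (\<lambda>_. 1) K \<le> emeasure lebesgue K"
  unfolding max_translate_ratio_def weighted_measure_one
proof (intro SUP_least, clarify)
  fix y :: "real ^ 'n" and \<theta> :: real assume \<theta>: "\<theta> \<in> {0<..1}"
  have "emeasure lebesgue ((\<lambda>s. (1 - \<theta>) *\<^sub>R y - \<theta> *\<^sub>R s) ` K) = emeasure lebesgue K * ennreal (\<theta> ^ CARD('n))"
    using emeasure_lebesgue_affine[of "- \<theta>" "(1 - \<theta>) *\<^sub>R y" K] \<theta>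
    by (simp add: mult.commute ennreal_power)
  then show "emeasure lebesgue ((\<lambda>s. (1 - \<theta>) *\<^sub>R y - \<theta> *\<^sub>R s) ` K) / ennreal (\<theta> ^ CARD('n)) \<le> emeasure lebesgue K"
    using \<theta> by (simp add: mult_divide_eq_ennreal)
qed

lemma layer_cake_le:
  fixes f :: "real ^ 'n \<Rightarrow> real"
  assumes f: "f \<in> borel_measurable lebesgue"
  shows "(\<integral>\<^sup>+t\<in>{0..}. emeasure lebesgue (superlevel t f) \<partial>lebesgue) \<le> (\<integral>\<^sup>+x. ennreal (f x) \<partial>lebesgue)"
proof -
  obtain g where g: "g \<in> borel_measurable lborel" and fg: "AE x in lborel. f x = g x"
    using completion_ex_borel_measurable_real[OF f] by blast
  have [measurable]: "g \<in> borel_measurable borel" using g by simp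
  have lev: "emeasure lebesgue (superlevel t f) = emeasure lborel {x. t \<le> g x}" for t
  proof -
    have "emeasure lebesgue (superlevel t f) = emeasure lebesgue {x. t \<le> g x}"
    proof (rule emeasure_eq_AE)
      show "AE x in lebesgue. x \<in> superlevel t f \<longleftrightarrow> x \<in> {x. t \<le> g x}"
        using AE_completion[OF fg] by eventually_elim (simp add: superlevel_def)
      show "superlevel t f \<in> sets lebesgue" using f by (rule sets_lebesgue_superlevel)
      show "{x. t \<le> g x} \<in> sets lebesgue" by (intro sets_completionI_sets) measurable
    qed
    then show ?thesis by simp
  qed
  define W where "W = {(x, t). 0 \<le> t \<and> t \<le> g x}"
  have W: "W \<in> sets (lborel \<Otimes>\<^sub>M lborel)"
  proof -
    have "W = {p \<in> space (lborel \<Otimes>\<^sub>M lborel). 0 \<le> snd p \<and> snd p \<le> g (fst p)}"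
      by (auto simp: W_def space_pair_measure)
    also have "\<dots> \<in> sets (lborel \<Otimes>\<^sub>M lborel)" by measurable
    finally show ?thesis .
  qed
  have "(\<integral>\<^sup>+t\<in>{0..}. emeasure lebesgue (superlevel t f) \<partial>lebesgue)
      = (\<integral>\<^sup>+t. emeasure lborel {x. t \<le> g x} * indicator {0..} t \<partial>lborel)"
    unfolding lev by (rule nn_integral_completion)
  also have "\<dots> = (\<integral>\<^sup>+t. emeasure lborel ((\<lambda>x. (x, t)) -` W) \<partial>lborel)"
    by (intro nn_integral_cong) (auto simp: W_def vimage_def split: split_indicator)
  also have "\<dots> = (\<integral>\<^sup>+x. emeasure lborel (Pair x -` W) \<partial>lborel)"
    using W by (simp add: lborel_pair.emeasure_pair_measure_alt2[symmetric] lborel.emeasure_pair_measure_alt)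
  also have "\<dots> = (\<integral>\<^sup>+x. ennreal (g x) \<partial>lborel)"
  proof (intro nn_integral_cong)
    fix x
    have "Pair x -` W = {0..g x}" by (auto simp: W_def)
    then show "emeasure lborel (Pair x -` W) = ennreal (g x)"
      by (cases "0 \<le> g x") (auto simp: ennreal_neg)
  qed
  also have "\<dots> = (\<integral>\<^sup>+x. ennreal (f x) \<partial>lborel)"
    using fg by (intro nn_integral_cong_AE) auto
  also have "\<dots> = (\<integral>\<^sup>+x. ennreal (f x) \<partial>lebesgue)"
    by (rule nn_integral_completion[symmetric])
  finally show ?thesis by simp
qed

theorem theorem2p4:
  fixes f \<phi> :: "real ^ 'n \<Rightarrow> real"
  assumes f_nonneg: "\<And>x. 0 \<le> f x"
    and f_integrable: "integrable lebesgue f"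
    and f_quasi_concave: "quasi_concave f"
    and phi_nonneg: "\<And>x. 0 \<le> \<phi> x"
    and phi_measurable: "\<phi> \<in> borel_measurable lebesgue"
    and phi_radially_decreasing: "radially_decreasing \<phi>"
  shows
    "((\<integral>\<^sup>+\<theta>\<in>{0..1}. (\<integral>\<^sup>+x. Delta \<theta> f x \<partial>weighted_measure \<phi>) \<partial>lebesgue)
        \<le> ennreal (2 ^ CARD('n) / (real CARD('n) + 1)) *
          (\<integral>\<^sup>+t\<in>{0..}. (SUP (y, \<theta>) \<in> superlevel t f \<times> {0<..1}.
             emeasure (weighted_measure \<phi>)
               ((\<lambda>s. (1 - \<theta>) *\<^sub>R y - \<theta> *\<^sub>R s) ` superlevel t f) / ennreal (\<theta> ^ CARD('n))) \<partial>lebesgue)) \<and>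
     ((\<forall>x. f x \<le> f 0) \<longrightarrow>
        (\<integral>\<^sup>+x. Delta_tilde f x \<partial>weighted_measure \<phi>)
        \<le> 2 ^ CARD('n) *
          (\<integral>\<^sup>+t\<in>{0..}. (SUP (y, \<theta>) \<in> superlevel t f \<times> {0<..1}.
             emeasure (weighted_measure \<phi>)
               ((\<lambda>s. (1 - \<theta>) *\<^sub>R y - \<theta> *\<^sub>R s) ` superlevel t f) / ennreal (\<theta> ^ CARD('n))) \<partial>lebesgue)) \<and>
     ((\<integral>\<^sup>+\<theta>\<in>{0..1}. (\<integral>\<^sup>+x. Delta \<theta> f x \<partial>lebesgue) \<partial>lebesgue)
        \<le> ennreal (2 ^ CARD('n) / (real CARD('n) + 1)) * (\<integral>\<^sup>+x. ennreal (f x) \<partial>lebesgue)) \<and>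
     ((\<forall>x. f x \<le> f 0) \<longrightarrow>
        (\<integral>\<^sup>+x. Delta_tilde f x \<partial>lebesgue)
        \<le> 2 ^ CARD('n) * (\<integral>\<^sup>+x. ennreal (f x) \<partial>lebesgue))"
proof -
  note weighted = weighted_Delta_integral_bounds[OF f_integrable f_quasi_concave]
  have "radially_decreasing (\<lambda>_ :: real ^ 'n. 1)" by (simp add: radially_decreasing_def)
  note lebesgue = weighted[OF borel_measurable_const this, unfolded weighted_measure_one]
  have "(\<integral>\<^sup>+t\<in>{0..}. max_translate_ratio (\<lambda>_. 1) (superlevel t f) \<partial>lebesgue)
      \<le> (\<integral>\<^sup>+t\<in>{0..}. emeasure lebesgue (superlevel t f) \<partial>lebesgue)"
    by (intro nn_integral_mono mult_right_mono max_translate_ratio_one_le) simp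
  also have "\<dots> \<le> (\<integral>\<^sup>+x. ennreal (f x) \<partial>lebesgue)"
    using f_integrable by (intro layer_cake_le) auto
  finally have cake: "(\<integral>\<^sup>+t\<in>{0..}. max_translate_ratio (\<lambda>_. 1) (superlevel t f) \<partial>lebesgue)
      \<le> (\<integral>\<^sup>+x. ennreal (f x) \<partial>lebesgue)" .
  show ?thesis
    using weighted[OF phi_measurable phi_radially_decreasing, unfolded max_translate_ratio_def]
      order_trans[OF lebesgue(1) mult_left_mono[OF cake]]
      order_trans[OF lebesgue(2) mult_left_mono[OF cake]]
    by simp
qed

end
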